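(* For all integers $n\ge 0$, $$\overline{R_{4,9}}(18n+12)\equiv 0 \pmod 3 \qquad\text{and}\qquad \overline{R_{4,9}}(18n+15)\equiv 0 \pmod 3.$$
   Context: An overpartition of a nonnegative integer $n$ is a partition of $n$ (a non-increasing sequence of positive integers summing to $n$) in which the first occurrence of each part size may be overlined. For coprime positive integers $\ell,\mu$, $\overline{R_{\ell,\mu}}(n)$ denotes the number of overpartitions of $n$ in which no part is divisible by $\ell$ or by $\mu$ (with $\overline{R_{\ell,\mu}}(0)=1$). Its generating function, for $|q|<1$, is $$\sum_{n\ge 0}\overline{R_{\ell,\mu}}(n)q^n=\prod_{n=1}^{\infty}\frac{(1+q^{n})(1-q^{\ell n})(1-q^{\mu n})(1+q^{\ell\mu n})}{(1-q^{n})(1+q^{\ell n})(1+q^{\mu n})(1-q^{\ell\mu n})}.$$ The claim concerns $(\ell,\mu)=(4,9)$. *)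

theory Defs
  imports "HOL-Number_Theory.Cong"
begin

definition partitions :: "nat \<Rightarrow> nat list set" where
  "partitions n = {xs. sorted_wrt (\<ge>) xs \<and> (\<forall>x\<in>set xs. 0 < x) \<and> sum_list xs = n}"

definition first_occurrences :: "'a list \<Rightarrow> nat set" where
  "first_occurrences xs = {i. i < length xs \<and> (\<forall>j<i. xs ! j \<noteq> xs ! i)}"

text \<open>An overpartition is a partition \<open>xs\<close> together with the set \<open>S\<close> of the (0-based) positions
  in \<open>xs\<close> that carry an overline.\<close>

definition overpartitions :: "nat \<Rightarrow> (nat list \<times> nat set) set" where
  "overpartitions n = {(xs, S). xs \<in> partitions n \<and> S \<subseteq> first_occurrences xs}"

definition Rbar :: "nat \<Rightarrow> nat \<Rightarrow> nat \<Rightarrow> nat" where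
  "Rbar l m n =
     card {(xs, S) \<in> overpartitions n. \<forall>x\<in>set xs. \<not> l dvd x \<and> \<not> m dvd x}"

lemma length_le_sum_list:
  fixes xs :: "nat list"
  assumes "\<forall>x\<in>set xs. 0 < x"
  shows "length xs \<le> sum_list xs"
  using assms by (induction xs) auto

lemma finite_overpartitions: "finite (overpartitions n)"
proof (rule finite_subset)
  show "overpartitions n \<subseteq> {xs. set xs \<subseteq> {..n} \<and> length xs \<le> n} \<times> Pow {..<n}"
  proof (rule subrelI)
    fix xs S
    assume "(xs, S) \<in> overpartitions n"
    then have pos: "\<forall>x\<in>set xs. 0 < x" and sum: "sum_list xs = n"
      and S: "S \<subseteq> {..<length xs}"
      unfolding overpartitions_def partitions_def first_occurrences_def by blast+
    have len: "length xs \<le> n"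
      using length_le_sum_list[OF pos] sum by simp
    have "set xs \<subseteq> {..n}"
    proof
      fix x assume "x \<in> set xs"
      from member_le_sum_list[OF this] sum show "x \<in> {..n}" by simp
    qed
    moreover have "S \<subseteq> {..<n}"
      using S len by fastforce
    ultimately show "(xs, S) \<in> {xs. set xs \<subseteq> {..n} \<and> length xs \<le> n} \<times> Pow {..<n}"
      using len by blast
  qed
  show "finite ({xs::nat list. set xs \<subseteq> {..n} \<and> length xs \<le> n} \<times> Pow {..<n})"
    by (intro finite_cartesian_product finite_lists_length_le) simp_all
qed

lemma Rbar_0: "Rbar l m 0 = 1"
proof -
  have "partitions 0 = {[]}"
  proof (intro equalityI subsetI)
    fix xs assume "xs \<in> partitions 0"
    then show "xs \<in> {[]}"
      unfolding partitions_def by (cases xs) simp_all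
  qed (simp add: partitions_def)
  moreover have "first_occurrences [] = {}"
    by (simp add: first_occurrences_def)
  ultimately have "overpartitions 0 = {([], {})}"
    unfolding overpartitions_def by fastforce
  then have "{(xs, S) \<in> overpartitions 0. \<forall>x\<in>set xs. \<not> l dvd x \<and> \<not> m dvd x} = {([], {})}"
    by fastforce
  then show ?thesis
    unfolding Rbar_def by simp
qed

end

theory Submission
  imports Defs "HOL-Computational_Algebra.Formal_Power_Series" "HOL-Library.Multiset"
begin

text \<open>
  Write \<open>\<theta>\<^sub>k = \<Sum> (-1)\<^sup>x q\<^bsup>k x^2\<^esup>\<close>, the sum over all integers \<open>x\<close>. Gauss's identity says that
  \<open>\<theta>\<^sub>k\<close> is the reciprocal of the generating function of overpartitions into multiples of \<open>k\<close>
  (\<open>theta_mult_overpart_series\<close>). Inclusion-exclusion on the allowed parts therefore gives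
  \<open>R \<theta>\<^sub>1 \<theta>\<^sub>3\<^sub>6 = \<theta>\<^sub>4 \<theta>\<^sub>9\<close> for the series \<open>R\<close> of the numbers \<open>Rbar 4 9 n\<close> (\<open>Rbar_series\<close>). Multiply by
  \<open>\<theta>\<^sub>1\<^sup>2 \<theta>\<^sub>3\<^sup>2\<close>. Modulo 3 the cube of \<open>\<theta>\<^sub>k\<close> is \<open>\<theta>\<^bsub>3k\<^esub>\<close>, so \<open>\<theta>\<^sub>1\<^sup>3 \<theta>\<^sub>3\<^sup>2\<close> becomes \<open>\<theta>\<^sub>9\<close>, which cancels:
  \<open>R \<theta>\<^sub>3\<^sub>6 \<equiv> \<theta>\<^sub>4 \<theta>\<^sub>1\<^sup>2 \<theta>\<^sub>3\<^sup>2\<close> (\<open>Rbar_series_mod_3\<close>). Since \<open>\<theta>\<^sub>3\<^sub>6\<close> starts with 1 and is a series in \<open>q\<^sup>1\<^sup>8\<close>,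
  the coefficients of \<open>R\<close> in a residue class modulo 18 vanish modulo 3 as soon as those of the right
  side do.

  Up to sign, the coefficient of \<open>q\<^sup>n\<close> on the right is the sum of \<open>(-1)\<^sup>a r(n - 4 a\<^sup>2)\<close> over all integers
  \<open>a\<close>, where \<open>r(m)\<close> counts the solutions of \<open>b\<^sup>2 + c\<^sup>2 + 3 d\<^sup>2 + 3 e\<^sup>2 = m\<close>. Multiplication by a cube root
  of unity in the Eisenstein integers is a symmetry of order three of \<open>x\<^sup>2 + 3 y\<^sup>2\<close>, available whenever
  \<open>x + y\<close> is even; modulo 3 only its fixed points count. Together with the parities that occur
  in each class of \<open>m\<close> modulo 4, this yields three rules, with \<open>s(m)\<close> the number of solutions of \<open>x\<^sup>2 + 3 y\<^sup>2 = m\<close>: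
  \<^item> \<open>r(m) \<equiv> 2 s(m)\<close> for odd \<open>m\<close> (\<open>card_quaternary_odd\<close>),
  \<^item> \<open>r(2 m) = r(m)\<close> for odd \<open>m\<close> (\<open>card_quaternary_double\<close>),
  \<^item> \<open>r(4 m) \<equiv> (-1)\<^sup>m r(m)\<close> for all \<open>m\<close> (\<open>card_quaternary_quadruple\<close>).

  For \<open>n\<close> congruent to 15 modulo 18 the first rule suffices: \<open>4 a\<^sup>2 + x\<^sup>2 + 3 y\<^sup>2 = n\<close> has no solutions
  modulo 9. For \<open>n\<close> congruent to 12 there are two cases. If \<open>n = 2 m\<close> with \<open>m\<close> odd, the first two rules
  reduce the claim to the vanishing of the sum of \<open>(-1)\<^sup>a\<close> over the solutions of
  \<open>2 a\<^sup>2 + v\<^sup>2 + 3 t\<^sup>2 = m\<close>, on which a sign-reversing involution coming from \<open>\<int>[\<surd>-2]\<close> acts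
  (\<open>signed_ternary_sum_zero\<close>). If \<open>n = 4 m\<close>, the third rule leaves the number of solutions of
  \<open>a\<^sup>2 + b\<^sup>2 + c\<^sup>2 + 3 d\<^sup>2 + 3 e\<^sup>2 = m\<close>; cyclic permutations of three variables, used twice, reduce it modulo
  3 to the number of solutions of \<open>9 a\<^sup>2 = m\<close>, which is zero as \<open>m\<close> is 3 modulo 9 (\<open>card_quinary_mod_3\<close>).
\<close>

unbundle fps_syntax

section \<open>Counting modulo 3 with symmetries of order three\<close>

text \<open>Every orbit of \<open>f\<close> that is not a fixed point has three elements of equal weight. The induction
  removes one such orbit at a time.\<close>
lemma sum_eq_sum_fixed_points_mod_3:
  fixes w :: "'a \<Rightarrow> int"
  assumes "finite X"
    and "\<And>x. x \<in> X \<Longrightarrow> f x \<in> X" "\<And>x. x \<in> X \<Longrightarrow> f (f (f x)) = x"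
    and "\<And>x. x \<in> X \<Longrightarrow> w (f x) = w x"
  shows "3 dvd sum w X - sum w {x \<in> X. f x = x}"
  using assms
proof (induction X rule: finite_psubset_induct)
  case (psubset X)
  show ?case
  proof (cases "\<forall>x\<in>X. f x = x")
    case True
    then have "{x \<in> X. f x = x} = X" by blast
    then show ?thesis by simp
  next
    case False
    then obtain x where x: "x \<in> X" "f x \<noteq> x" by blast
    let ?O = "{x, f x, f (f x)}"
    have f3: "f (f (f x)) = x" and in1: "f x \<in> X" and in2: "f (f x) \<in> X"
      using x psubset.prems by auto
    have d: "f (f x) \<noteq> x" "f (f x) \<noteq> f x"
      using x f3 psubset.prems(2)[OF in1] by metis+
    have O: "?O \<subseteq> X" using x in1 in2 by simp
    have closed: "f y \<in> X - ?O" if "y \<in> X - ?O" for y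
    proof -
      have "f y \<notin> ?O"
      proof
        assume "f y \<in> ?O"
        then have "f (f (f y)) \<in> ?O" using f3 by auto
        then show False using that psubset.prems(2)[of y] by auto
      qed
      then show ?thesis using that psubset.prems(1) by auto
    qed
    have dvd: "3 dvd sum w (X - ?O) - sum w {y \<in> X - ?O. f y = y}"
      using psubset.prems closed x by (intro psubset.IH) auto
    have fixed: "{y \<in> X - ?O. f y = y} = {y \<in> X. f y = y}"
      using x d f3 by auto
    have orbit: "sum w ?O = 3 * w x"
      using x d psubset.prems(3)[OF x(1)] psubset.prems(3)[OF in1] by auto
    have split: "sum w X = sum w (X - ?O) + sum w ?O"
      using sum.subset_diff[OF O psubset.hyps] .
    have "sum w X - sum w {y \<in> X. f y = y}
        = (sum w (X - ?O) - sum w {y \<in> X - ?O. f y = y}) + 3 * w x"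
      unfolding split orbit fixed by (rule add_diff_eq[symmetric, THEN trans]) (simp only: algebra_simps)
    then show ?thesis
      using dvd_add[OF dvd dvd_triv_left[of 3 "w x"]] by (simp only:)
  qed
qed

corollary card_eq_card_fixed_points_mod_3:
  assumes "finite X" "F \<subseteq> X"
    and "\<And>x. x \<in> X \<Longrightarrow> f x \<in> X \<and> f (f (f x)) = x \<and> (f x = x \<longleftrightarrow> x \<in> F)"
  shows "(3::int) dvd int (card X) - int (card F)"
proof -
  have "{x \<in> X. f x = x} = F" using assms by blast
  then show ?thesis
    using sum_eq_sum_fixed_points_mod_3[of X f "\<lambda>_. 1"] assms by simp
qed

lemma sum_slices:
  fixes g :: "'a \<Rightarrow> int"
  assumes "finite A" "finite Z" "fst ` Z \<subseteq> A"
  shows "(\<Sum>z\<in>Z. g (fst z)) = (\<Sum>a\<in>A. g a * int (card {y. (a, y) \<in> Z}))"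
proof -
  have fin: "finite {y. (a, y) \<in> Z}" for a
  proof (rule finite_subset)
    show "{y. (a, y) \<in> Z} \<subseteq> snd ` Z" by force
    show "finite (snd ` Z)" using assms(2) by simp
  qed
  have "Sigma A (\<lambda>a. {y. (a, y) \<in> Z}) = Z"
    using assms(3) by (auto simp: image_subset_iff)
  then have "(\<Sum>z\<in>Z. g (fst z)) = (\<Sum>(a, y)\<in>Sigma A (\<lambda>a. {y. (a, y) \<in> Z}). g a)"
    by (simp add: case_prod_beta)
  also have "\<dots> = (\<Sum>a\<in>A. \<Sum>y\<in>{y. (a, y) \<in> Z}. g a)"
    using fin by (intro sum.Sigma[symmetric] assms(1)) simp
  finally show ?thesis by (simp add: mult.commute)
qed

definition parity_sign :: "int \<Rightarrow> int" where
  "parity_sign x = (if even x then 1 else -1)"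

lemma parity_sign_add: "parity_sign (x + y) = parity_sign x * parity_sign y"
  by (simp add: parity_sign_def)

section \<open>Generating functions of weighted sets\<close>

text \<open>The coefficient of \<open>q\<^sup>n\<close> adds up the weights \<open>w\<close> of the elements of \<open>S\<close> of size \<open>e x = n\<close>. All
  series below are of this form, so that identities between them can be read off from bijections. The
  definition is meant for sizes with finite fibres; over an infinite fibre the sum is 0.\<close>
definition weighted_series :: "'a set \<Rightarrow> ('a \<Rightarrow> nat) \<Rightarrow> ('a \<Rightarrow> int) \<Rightarrow> int fps" where
  "weighted_series S e w = Abs_fps (\<lambda>n. \<Sum>x\<in>{x\<in>S. e x = n}. w x)"

lemma weighted_series_nth: "weighted_series S e w $ n = (\<Sum>x\<in>{x\<in>S. e x = n}. w x)"
  by (simp add: weighted_series_def)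

lemma weighted_series_mult:
  assumes "\<And>n. finite {x\<in>S. e x = n}" "\<And>n. finite {y\<in>T. f y = n}"
  shows "weighted_series S e w * weighted_series T f v = weighted_series (S \<times> T) (\<lambda>(x, y). e x + f y)
      (\<lambda>(x, y). w x * v y)"
proof (rule fps_ext)
  fix n
  let ?P = "\<lambda>i. {x\<in>S. e x = i} \<times> {y\<in>T. f y = n - i}"
  have "(weighted_series S e w * weighted_series T f v) $ n = (\<Sum>i=0..n. \<Sum>(x, y)\<in>?P i. w x * v y)"
    by (simp add: fps_mult_nth weighted_series_nth sum_product sum.cartesian_product)
  also have "\<dots> = (\<Sum>(x, y)\<in>(\<Union>i\<in>{0..n}. ?P i). w x * v y)"
    using assms by (intro sum.UNION_disjoint[symmetric]) auto
  also have "(\<Union>i\<in>{0..n}. ?P i) = {z \<in> S \<times> T. (\<lambda>(x, y). e x + f y) z = n}"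
    by auto
  finally show "(weighted_series S e w * weighted_series T f v) $ n
      = weighted_series (S \<times> T) (\<lambda>(x, y). e x + f y) (\<lambda>(x, y). w x * v y) $ n"
    by (simp add: weighted_series_nth)
qed

lemma finite_fibres_Times:
  fixes e :: "'a \<Rightarrow> nat" and f :: "'b \<Rightarrow> nat"
  assumes "\<And>n. finite {x\<in>S. e x = n}" "\<And>n. finite {y\<in>T. f y = n}"
  shows "finite {z \<in> S \<times> T. (\<lambda>(x, y). e x + f y) z = n}"
proof (rule finite_subset)
  show "{z \<in> S \<times> T. (\<lambda>(x, y). e x + f y) z = n}
      \<subseteq> (\<Union>i\<in>{0..n}. {x\<in>S. e x = i} \<times> {y\<in>T. f y = n - i})"
    by auto
  show "finite (\<Union>i\<in>{0..n}. {x\<in>S. e x = i} \<times> {y\<in>T. f y = n - i})"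
    using assms by blast
qed

lemma weighted_series_reindex:
  assumes h: "bij_betw h S T"
    and e: "\<And>x. x \<in> S \<Longrightarrow> f (h x) = e x"
        and w: "\<And>x. x \<in> S \<Longrightarrow> v (h x) = w x"
  shows "weighted_series S e w = weighted_series T f v"
proof (rule fps_ext)
  fix n
  have "bij_betw h {x\<in>S. e x = n} {y\<in>T. f y = n}"
    by (rule bij_betw_subset[OF h]) (use h e in \<open>auto simp: bij_betw_def\<close>)
  from sum.reindex_bij_betw[OF this, of v]
  show "weighted_series S e w $ n = weighted_series T f v $ n"
    by (simp add: weighted_series_nth w)
qed

section \<open>Overpartitions with prescribed parts\<close>

text \<open>A partition is a multiset of parts, and each distinct part size is overlined or not, whence the
  weight.\<close>
definition overpart_series :: "nat set \<Rightarrow> int fps" where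
  "overpart_series S =
     weighted_series {M. set_mset M \<subseteq> S} sum_mset (\<lambda>M. 2 ^ card (set_mset M))"

lemma size_le_sum_mset:
  fixes M :: "nat multiset"
  assumes "0 \<notin># M"
  shows "size M \<le> \<Sum>\<^sub># M"
  using assms by (induction M) auto

lemma elem_le_sum_mset:
  fixes M :: "nat multiset"
  assumes "x \<in># M"
  shows "x \<le> \<Sum>\<^sub># M"
  using assms by (induction M) auto

lemma finite_mset_fibres:
  fixes S :: "nat set"
  assumes "0 \<notin> S"
  shows "finite {M \<in> {M. set_mset M \<subseteq> S}. \<Sum>\<^sub># M = n}"
proof (rule finite_subset)
  show "{M \<in> {M. set_mset M \<subseteq> S}. \<Sum>\<^sub># M = n}
      \<subseteq> mset ` {xs. set xs \<subseteq> {..n} \<and> length xs \<le> n}"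
  proof
    fix M assume M: "M \<in> {M \<in> {M. set_mset M \<subseteq> S}. \<Sum>\<^sub># M = n}"
    then have "0 \<notin># M" using assms by auto
    obtain xs where xs: "M = mset xs" using ex_mset by metis
    have "set xs \<subseteq> {..n}" using elem_le_sum_mset[of _ M] M xs by auto
    moreover have "length xs \<le> n" using size_le_sum_mset[OF \<open>0 \<notin># M\<close>] M xs by simp
    ultimately show "M \<in> mset ` {xs. set xs \<subseteq> {..n} \<and> length xs \<le> n}" using xs by blast
  qed
  show "finite (mset ` {xs. set xs \<subseteq> {..n} \<and> length xs \<le> n})"
    by (intro finite_imageI finite_lists_length_le) simp
qed

text \<open>A multiset over a disjoint union splits uniquely into its two restrictions, and the number of
  distinct elements is additive.\<close>
lemma overpart_series_Un:
  assumes "S \<inter> T = {}" "0 \<notin> S" "0 \<notin> T"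
  shows "overpart_series (S \<union> T) = overpart_series S * overpart_series T"
proof -
  let ?U = "\<lambda>S. {M::nat multiset. set_mset M \<subseteq> S}"
  have "bij_betw (\<lambda>(M, N). M + N) (?U S \<times> ?U T) (?U (S \<union> T))"
  proof (rule bij_betw_byWitness[where f' = "\<lambda>M. (filter_mset (\<lambda>x. x \<in> S) M, filter_mset (\<lambda>x. x \<in> T) M)"])
    have "filter_mset (\<lambda>x. x \<in> S) M = M" "filter_mset (\<lambda>x. x \<in> T) M = {#}" if "set_mset M \<subseteq> S" for M
      using that assms(1) by (auto simp: filter_mset_eq_conv)
    moreover have "filter_mset (\<lambda>x. x \<in> T) M = M" "filter_mset (\<lambda>x. x \<in> S) M = {#}" if "set_mset M \<subseteq> T" for M
      using that assms(1) by (auto simp: filter_mset_eq_conv)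
    ultimately show "\<forall>a\<in>?U S \<times> ?U T.
        (filter_mset (\<lambda>x. x \<in> S) (case a of (M, N) \<Rightarrow> M + N),
         filter_mset (\<lambda>x. x \<in> T) (case a of (M, N) \<Rightarrow> M + N)) = a"
      by auto
    show "\<forall>M\<in>?U (S
        \<union> T). (case (filter_mset (\<lambda>x. x \<in> S) M, filter_mset (\<lambda>x. x \<in> T) M) of
        (M, N) \<Rightarrow> M + N) = M"
    proof
      fix M assume "M \<in> ?U (S \<union> T)"
      then have "filter_mset (\<lambda>x. x \<in> T) M = filter_mset (\<lambda>x. x \<notin> S) M"
        using assms(1) by (intro filter_mset_cong) auto
      then show "(case (filter_mset (\<lambda>x. x \<in> S) M, filter_mset (\<lambda>x. x \<in> T) M) of
        (M, N) \<Rightarrow> M + N) = M"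
        using multiset_partition[of M "\<lambda>x. x \<in> S"] by simp
    qed
  qed auto
  then have "weighted_series (?U S \<times> ?U T) (\<lambda>(M, N). \<Sum>\<^sub># M + \<Sum>\<^sub># N)
      (\<lambda>(M, N). 2 ^ card (set_mset M) * 2 ^ card (set_mset N)) = overpart_series (S \<union> T)"
    unfolding overpart_series_def
  proof (rule weighted_series_reindex)
    fix z assume z: "z \<in> ?U S \<times> ?U T"
    then have "set_mset (fst z) \<inter> set_mset (snd z) = {}"
      using assms(1) by (auto, blast)
    then show "2 ^ card (set_mset (case z of (M, N) \<Rightarrow> M + N))
        = (case z of (M, N) \<Rightarrow> (2::int) ^ card (set_mset M) * 2 ^ card (set_mset N))"
      by (auto simp: case_prod_beta card_Un_disjoint power_add)
  qed auto
  then show ?thesis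
    unfolding overpart_series_def using assms
    by (subst weighted_series_mult) (auto intro: finite_mset_fibres[simplified])
qed

definition geometric_series :: "nat \<Rightarrow> int fps" where
  "geometric_series k = Abs_fps (\<lambda>n. if k dvd n then 1 else 0)"

lemma geometric_series_inverse:
  assumes "k > 0"
  shows "(1 - fps_X ^ k) * geometric_series k = 1"
proof (rule fps_ext)
  fix n
  have "k dvd n - k \<longleftrightarrow> k dvd n" if "\<not> n < k"
    using that dvd_minus_self by auto
  then show "((1 - fps_X ^ k) * geometric_series k) $ n = 1 $ n"
    using assms by (auto simp: geometric_series_def left_diff_distrib fps_X_power_mult_nth dvd_imp_le)
qed

lemma overpart_series_singleton:
  assumes "k > 0"
  shows "overpart_series {k} = (1 + fps_X ^ k) * geometric_series k"
proof -
  have "bij_betw (\<lambda>j. replicate_mset j k) UNIV {M. set_mset M \<subseteq> {k}}"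
    by (rule bij_betw_byWitness[where f' = size])
      (auto simp: set_mset_subset_singletonD[symmetric] split: if_splits)
  then have "weighted_series UNIV (\<lambda>j. j * k) (\<lambda>j. if j = 0 then 1 else 2) = overpart_series {k}"
    unfolding overpart_series_def by (rule weighted_series_reindex) auto
  also have "weighted_series UNIV (\<lambda>j. j * k) (\<lambda>j. if j = 0 then 1 else 2) = 2 * geometric_series k - 1"
  proof (rule fps_ext)
    fix n
    have *: "{j. j * k = n} = (if k dvd n then {n div k} else {})"
      using assms by auto
    show "weighted_series UNIV (\<lambda>j. j * k) (\<lambda>j. if j = 0 then 1 else 2) $ n = (2 * geometric_series k - 1) $ n"
      using assms by (
          auto simp: weighted_series_nth * geometric_series_def numeral_fps_const div_eq_0_iff dest: dvd_imp_le)
  qed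
  also have "\<dots> = (1 + fps_X ^ k) * geometric_series k"
    using geometric_series_inverse[OF assms] by (simp add: algebra_simps)
  finally show ?thesis by simp
qed

lemma finite_partitions: "finite (partitions n)"
proof (rule finite_subset)
  show "partitions n \<subseteq> fst ` overpartitions n"
    by (force simp: overpartitions_def)
qed (simp add: finite_overpartitions)

lemma card_first_occurrences: "card (first_occurrences xs) = card (set xs)"
proof (rule bij_betw_same_card)
  show "bij_betw ((!) xs) (first_occurrences xs) (set xs)"
    unfolding bij_betw_def
  proof (intro conjI equalityI subsetI)
    show "inj_on ((!) xs) (first_occurrences xs)"
      by (rule linorder_inj_onI) (auto simp: first_occurrences_def)
  next
    fix x assume "x \<in> set xs"
    then have ex: "\<exists>i. i < length xs \<and> xs ! i = x" by (auto simp: in_set_conv_nth)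
    obtain i where i: "i < length xs" "xs ! i = x" "\<And>j. j < i \<Longrightarrow> \<not> (j < length xs \<and> xs ! j = x)"
      using exists_least_iff[THEN iffD1, OF ex] by blast
    then have "i \<in> first_occurrences xs"
      by (auto simp: first_occurrences_def)
    then show "x \<in> (!) xs ` first_occurrences xs"
      using i(2) by blast
  qed (auto simp: first_occurrences_def)
qed

lemma bij_betw_mset_partitions:
  assumes "0 \<notin> T"
  shows "bij_betw mset {xs \<in> partitions n. set xs \<subseteq> T} {M \<in> {M. set_mset M \<subseteq> T}. \<Sum>\<^sub># M = n}"
proof (rule bij_betw_byWitness[where f' = "\<lambda>M. rev (sorted_list_of_multiset M)"])
  show "\<forall>xs\<in>{xs \<in> partitions n. set xs \<subseteq> T}. rev (sorted_list_of_multiset (mset xs)) = xs"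
  proof
    fix xs assume "xs \<in> {xs \<in> partitions n. set xs \<subseteq> T}"
    then have "sorted (rev xs)" by (simp add: partitions_def sorted_wrt_rev)
    then have "sort xs = rev xs" by (intro properties_for_sort) simp_all
    then show "rev (sorted_list_of_multiset (mset xs)) = xs" by simp
  qed
  show "\<forall>M\<in>{M \<in> {M. set_mset M \<subseteq> T}. \<Sum>\<^sub># M
      = n}. mset (rev (sorted_list_of_multiset M)) = M"
    by simp
  show "mset ` {xs \<in> partitions n. set xs \<subseteq> T} \<subseteq> {M \<in> {M. set_mset M \<subseteq> T}. \<Sum>\<^sub># M = n}"
    by (auto simp: partitions_def sum_mset_sum_list)
  show "(\<lambda>M. rev (sorted_list_of_multiset M)) ` {M \<in> {M. set_mset M \<subseteq> T}. \<Sum>\<^sub># M = n}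
      \<subseteq> {xs \<in> partitions n. set xs \<subseteq> T}"
  proof clarify
    fix M assume M: "set_mset M \<subseteq> T"
    have "sum_list (sorted_list_of_multiset M) = \<Sum>\<^sub># M"
      by (metis mset_sorted_list_of_multiset sum_mset_sum_list)
    moreover have "\<forall>x\<in>#M. 0 < x" using M assms by (metis gr0I subsetD)
    ultimately show "rev (sorted_list_of_multiset M) \<in> partitions (\<Sum>\<^sub># M)
        \<and> set (rev (sorted_list_of_multiset M)) \<subseteq> T"
      using M by (simp add: partitions_def sorted_wrt_rev)
  qed
qed

lemma card_overpartitions_parts_in:
  assumes "0 \<notin> T"
  shows "int (card {(xs, S) \<in> overpartitions n. set xs \<subseteq> T}) = overpart_series T $ n"
proof -
  let ?P = "{xs \<in> partitions n. set xs \<subseteq> T}"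
  have fin: "finite (first_occurrences xs)" for xs :: "nat list"
    by (simp add: first_occurrences_def)
  have "{(xs, S) \<in> overpartitions n. set xs \<subseteq> T} = Sigma ?P (\<lambda>xs. Pow (first_occurrences xs))"
    by (auto simp: overpartitions_def)
  then have "card {(xs, S) \<in> overpartitions n. set xs \<subseteq> T} = (\<Sum>xs\<in>?P. 2 ^ card (set xs))"
    by (simp add: finite_partitions fin card_Pow card_first_occurrences)
  also have "int \<dots> = (\<Sum>xs\<in>?P. 2 ^ card (set_mset (mset xs)))"
    by simp
  also have "\<dots> = overpart_series T $ n"
    unfolding overpart_series_def weighted_series_nth
    by (rule sum.reindex_bij_betw[OF bij_betw_mset_partitions[OF assms]])
  finally show ?thesis .
qed

section \<open>Gauss's theta identity\<close>

text \<open>The partial sums of Gauss's series are compared with finite products by a telescoping sum, in the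
  manner of Shanks. In the application \<open>A s\<close> is the product of \<open>(1 + q\<^sup>j) / (1 - q\<^sup>j)\<close> over
  \<open>1 \<le> j \<le> s\<close>; the auxiliary \<open>B s = A s / (1 + q\<^sup>s) = A (s - 1) / (1 - q\<^sup>s)\<close> avoids
  division. The sum telescopes because
  \<open>q\<^sup>s (1 - q\<^sup>n) - (1 + q\<^sup>n) = - (1 - q\<^sup>s) - q\<^sup>n (1 + q\<^sup>s)\<close>.\<close>
lemma telescoping_sum:
  fixes q :: "'a::comm_ring_1"
  assumes "\<And>s. s \<ge> 1 \<Longrightarrow> (1 - q ^ s) * B s = A (s - 1)"
      "\<And>s. s \<ge> 1 \<Longrightarrow> (1 + q ^ s) * B s = A s"
  shows "(\<Sum>s=1..m. (-1) ^ s * ((1 - q ^ n) * q ^ (s * (n + 1)) - (1 + q ^ n) * q ^ (s * n)) * B s)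
      = q ^ n * A 0 - (-1) ^ m * q ^ ((m + 1) * n) * A m"
proof (induction m)
  case (Suc m)
  let ?s = "Suc m"
  have pow: "q ^ (?s * (n + 1)) = q ^ (?s * n) * q ^ ?s" "q ^ ((?s + 1) * n) = q ^ (?s * n) * q ^ n"
    by (simp_all add: algebra_simps flip: power_add)
  have "(-1) ^ ?s * ((1 - q ^ n) * q ^ (?s * (n + 1)) - (1 + q ^ n) * q ^ (?s * n)) * B ?s
      = (-1) ^ m * q ^ (?s * n) * ((1 - q ^ ?s) * B ?s + q ^ n * ((1 + q ^ ?s) * B ?s))"
    unfolding pow by (simp add: algebra_simps)
  also have "\<dots> = (-1) ^ m * q ^ (?s * n) * (A m + q ^ n * A ?s)"
    using assms[of ?s] by simp
  finally show ?case
    using Suc.IH pow(2) by (simp add: algebra_simps)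
qed simp

text \<open>An exact form of Gauss's identity: the error terms on the right are divisible by \<open>q\<^bsup>n+1\<^esup>\<close>. In the
  step from \<open>n\<close> to \<open>n + 1\<close> both sides are multiplied by \<open>1 - q\<^bsup>n+1\<^esup>\<close>; the error sums then differ
  by the telescoping sum above.\<close>
lemma finite_gauss_identity:
  fixes q :: "'a::idom"
  assumes B: "\<And>s. s \<ge> 1 \<Longrightarrow> (1 - q ^ s) * B s = A (s - 1)"
      "\<And>s. s \<ge> 1 \<Longrightarrow> (1 + q ^ s) * B s = A s"
    and A0: "A 0 = 1" and q: "\<And>n. n \<ge> 1 \<Longrightarrow> q ^ n \<noteq> 1"
    and S: "S 0 = 1" "\<And>n. S (Suc n) = S n + 2 * (-1) ^ Suc n * q ^ (Suc n * Suc n)"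
  shows "A n * S n = 1 + 2 * (\<Sum>s=1..n. (-1) ^ s * q ^ (s * (n + 1)) * B s)"
proof (induction n)
  case 0
  then show ?case by (simp add: A0 S)
next
  case (Suc n)
  let ?N = "Suc n"
  define u where "u = (-1) ^ ?N * q ^ (?N * ?N)"
  define L where "L = (\<Sum>s=1..?N. (-1) ^ s * q ^ (s * (?N + 1)) * B s)"
  define K where "K = (\<Sum>s=1..n. (-1) ^ s * q ^ (s * ?N) * B s)"
  have Bn: "(1 - q ^ ?N) * B ?N = A n" "(1 + q ^ ?N) * B ?N = A ?N" using B[of ?N] by simp_all
  have IH: "A n * S n = 1 + 2 * K" using Suc.IH by (simp add: K_def)
  have "(1 - q ^ ?N) * L - (1 + q ^ ?N) * (K + u * B ?N)
     = (\<Sum>s=1..?N. (-1) ^ s * ((1 - q ^ ?N) * q ^ (s * (?N + 1)) - (1 + q ^ ?N) * q ^ (s * ?N)) * B s)"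
  proof -
    have "K + u * B ?N = (\<Sum>s=1..?N. (-1) ^ s * q ^ (s * ?N) * B s)" by (simp add: K_def u_def)
    then show ?thesis
      unfolding L_def by (simp only: sum_distrib_left flip: sum_subtractf) (simp add: algebra_simps)
  qed
  also have "\<dots> = q ^ ?N - q ^ ?N * u * A ?N"
    using telescoping_sum[of q B A, OF B, of ?N ?N] by (simp add: A0 u_def power_add algebra_simps)
  finally have tele: "(1 - q ^ ?N) * L = (1 + q ^ ?N) * K + u * ((1 + q ^ ?N) * B ?N) + q ^ ?N - q ^ ?N * u * A ?N"
    by (simp add: algebra_simps)
  have "(1 - q ^ ?N) * (A ?N * S ?N) = (1 - q ^ ?N) * ((1 + q ^ ?N) * B ?N * S ?N)"
    using Bn by simp
  also have "\<dots> = (1 + q ^ ?N) * ((1 - q ^ ?N) * B ?N) * S ?N" by (simp only: ac_simps)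
  also have "\<dots> = (1 + q ^ ?N) * (A n * S n) + (1 + q ^ ?N) * A n * 2 * u"
    unfolding Bn S(2) u_def by (simp only: distrib_left ac_simps)
  also have "(1 + q ^ ?N) * A n * 2 * u = 2 * u * (1 - q ^ ?N) * ((1 + q ^ ?N) * B ?N)"
    unfolding Bn(1)[symmetric] by (simp only: ac_simps)
  also have "\<dots> = 2 * u * (1 - q ^ ?N) * A ?N" by (simp only: Bn)
  also have "(1 + q ^ ?N) * (A n * S n) + 2 * u * (1 - q ^ ?N) * A ?N = (1 - q ^ ?N) * (1 + 2 * L)"
  proof -
    have "(1 + p) * (1 + 2 * k) + 2 * v * (1 - p) * a = (1 - p) * (1 + 2 * l)"
      if "(1 - p) * l = (1 + p) * k + v * a + p - p * v * a" for p l k v a :: 'a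
      using that by algebra
    from this[OF tele[unfolded Bn(2)]] show ?thesis unfolding IH .
  qed
  finally show ?case using q[of ?N] unfolding L_def by simp
qed

definition theta :: "nat \<Rightarrow> int fps" where
  "theta k = weighted_series UNIV (\<lambda>x::int. k * nat \<bar>x\<bar> ^ 2) parity_sign"

lemma abs_le_of_theta_exponent:
  assumes "k > 0" "k * nat \<bar>x\<bar> ^ 2 \<le> n"
  shows "x \<in> {- int n..int n}"
proof -
  have "nat \<bar>x\<bar> \<le> nat \<bar>x\<bar> ^ 2" unfolding power2_eq_square by (rule le_square)
  also have "\<dots> \<le> n" using assms by (metis Suc_leI le_trans mult_le_mono1 nat_mult_1 One_nat_def)
  finally show ?thesis by auto
qed

lemma finite_theta_fibres:
  assumes "k > 0"
  shows "finite {x \<in> UNIV. k * nat \<bar>x::int\<bar> ^ 2 = n}"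
  by (rule finite_subset[of _ "{- int n..int n}"]) (use abs_le_of_theta_exponent[OF assms order.refl] in blast, simp)

definition theta_partial :: "nat \<Rightarrow> nat \<Rightarrow> int fps" where
  "theta_partial k n = (\<Sum>x\<in>{- int n..int n}. fps_const (parity_sign x) * fps_X ^ (k * nat \<bar>x\<bar> ^ 2))"

lemma theta_partial_nth:
  assumes "k > 0" "i \<le> n"
  shows "theta_partial k n $ i = theta k $ i"
proof -
  have "theta_partial k n $ i = (\<Sum>x\<in>{- int n..int n}. if k * nat \<bar>x\<bar> ^ 2 = i then parity_sign x else 0)"
    by (auto simp: theta_partial_def fps_sum_nth fps_X_power_nth intro!: sum.cong)
  also have "\<dots> = (\<Sum>x\<in>{x \<in> {- int n..int n}. k * nat \<bar>x\<bar> ^ 2 = i}. parity_sign x)"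
    by (rule sum.inter_filter[symmetric]) simp
  also have "{x \<in> {- int n..int n}. k * nat \<bar>x\<bar> ^ 2 = i} = {x \<in> UNIV. k * nat \<bar>x\<bar> ^ 2 = i}"
    using abs_le_of_theta_exponent[OF assms(1), of _ n] assms(2) by auto
  finally show ?thesis by (simp add: theta_def weighted_series_nth)
qed

lemma theta_partial_Suc:
  "theta_partial k (Suc n) = theta_partial k n + 2 * (-1) ^ Suc n * (fps_X ^ k) ^ (Suc n * Suc n)"
proof -
  have "{- int (Suc n)..int (Suc n)} = insert (int (Suc n)) (insert (- int (Suc n)) {- int n..int n})"
    by auto
  moreover have "fps_const (parity_sign (int m)) = (-1) ^ m" "parity_sign (- int m) = parity_sign (int m)" for m
    by (auto simp: parity_sign_def numeral_fps_const simp flip: fps_const_neg)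
  moreover have "nat \<bar>int m\<bar> = m" "nat \<bar>- int m\<bar> = m" for m by auto
  moreover have "(fps_X :: int fps) ^ (k * m ^ 2) = (fps_X ^ k) ^ (m * m)" for m
    by (simp only: power_mult[symmetric] power2_eq_square)
  ultimately show ?thesis
    by (simp add: theta_partial_def del: of_nat_Suc power_Suc mult_Suc mult_Suc_right)
qed

text \<open>Gauss's identity. The coefficient of \<open>q\<^sup>i\<close> only sees parts up to \<open>k i\<close> and summation indices
  up to \<open>i\<close>, so it can be read off from the finite identity with \<open>n = i\<close>, whose error terms
  have order larger than \<open>i\<close>.\<close>
lemma theta_mult_overpart_series:
  assumes k: "k > 0"
  shows "theta k * overpart_series {x. 0 < x \<and> k dvd x} = 1"
proof (rule fps_ext)
  fix i
  define A where "A n = overpart_series ((*) k ` {1..n})" for n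
  define B where "B s = A (s - 1) * geometric_series (k * s)" for s
  have A_step: "A s = A (s - 1) * overpart_series {k * s}" if "s \<ge> 1" for s
  proof -
    have "(*) k ` {1..s} = (*) k ` {1..s-1} \<union> {k * s}"
      using that by (cases s) (auto simp: atLeastAtMostSuc_conv)
    moreover have "(*) k ` {1..s-1} \<inter> {k * s} = {}" using k that by auto
    ultimately show ?thesis
      unfolding A_def using k that by (subst overpart_series_Un[symmetric]) auto
  qed
  have B1: "(1 - (fps_X ^ k) ^ s) * B s = A (s - 1)" if "s \<ge> 1" for s
    using geometric_series_inverse[of "k * s"] that k
    by (simp add: B_def power_mult[symmetric] mult.left_commute)
  have B2: "(1 + (fps_X ^ k) ^ s) * B s = A s" if "s \<ge> 1" for s
    using overpart_series_singleton[of "k * s"] A_step[OF that] that k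
    by (simp add: B_def power_mult[symmetric] mult.left_commute)
  have A0: "A 0 = 1"
  proof (rule fps_ext)
    fix n :: nat
    have "{M \<in> {M :: nat multiset. set_mset M \<subseteq> {}}. \<Sum>\<^sub># M = n} = (if n = 0 then {{#}} else {})" by auto
    then show "A 0 $ n = 1 $ n" by (simp add: A_def overpart_series_def weighted_series_nth)
  qed
  have q: "(fps_X ^ k) ^ n \<noteq> (1 :: int fps)" if "n \<ge> 1" for n
  proof
    assume "(fps_X ^ k) ^ n = (1 :: int fps)"
    then have "((fps_X ^ k) ^ n) $ 0 = (1 :: int fps) $ 0" by simp
    then show False using that k by (simp add: fps_X_power_nth flip: power_mult)
  qed
  have S0: "theta_partial k 0 = 1" by (simp add: theta_partial_def parity_sign_def)
  have A_nth: "overpart_series {x. 0 < x \<and> k dvd x} $ j = A n $ j" if "j \<le> n" for j n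
  proof -
    have "set_mset M \<subseteq> {x. 0 < x \<and> k dvd x} \<longleftrightarrow> set_mset M \<subseteq> (*) k ` {1..n}"
      if "\<Sum>\<^sub># M = j" for M
    proof
      assume M: "set_mset M \<subseteq> {x. 0 < x \<and> k dvd x}"
      show "set_mset M \<subseteq> (*) k ` {1..n}"
      proof
        fix x assume x: "x \<in># M"
        then obtain y where y: "x = k * y" using M by auto
        have "y \<le> x" using k y by simp
        also have "x \<le> n" using elem_le_sum_mset[OF x] that \<open>j \<le> n\<close> by simp
        finally show "x \<in> (*) k ` {1..n}" using M x y by auto
      qed
    qed (use k in auto)
    then show ?thesis
      by (auto simp: A_def overpart_series_def weighted_series_nth intro!: sum.cong)
  qed
  have "(theta k * overpart_series {x. 0 < x \<and> k dvd x}) $ i = (A i * theta_partial k i) $ i"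
    unfolding mult.commute[of "A i"] fps_mult_nth
    using A_nth theta_partial_nth[OF k] by (intro sum.cong) auto
  also have "A i * theta_partial k i
      = 1 + 2 * (\<Sum>s=1..i. (-1) ^ s * (fps_X ^ k) ^ (s * (i + 1)) * B s)"
    by (rule finite_gauss_identity[OF B1 B2 A0 q S0 theta_partial_Suc])
  also have "\<dots> = 1 + (\<Sum>s=1..i. fps_X ^ (k * (s * (i + 1))) * (2 * (-1) ^ s * B s))"
    by (simp add: sum_distrib_left power_mult mult_ac)
  also have "\<dots> $ i = 1 $ i"
  proof -
    have "i < k * (s * (i + 1))" if "s \<ge> 1" for s
    proof -
      have "1 * (1 * (i + 1)) \<le> k * (s * (i + 1))"
        using k that by (intro mult_le_mono) auto
      then show ?thesis by simp
    qed
    then show ?thesis by (simp add: fps_sum_nth fps_X_power_mult_nth)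
  qed
  finally show "(theta k * overpart_series {x. 0 < x \<and> k dvd x}) $ i = 1 $ i" .
qed

section \<open>The theta quotient for overpartitions avoiding multiples\<close>

text \<open>Inclusion-exclusion: an overpartition into arbitrary parts consists of one into parts divisible by
  neither \<open>l\<close> nor \<open>m\<close> and one into multiples of \<open>l\<close> or \<open>m\<close>; multiples of both are the multiples
  of \<open>l * m\<close>. By Gauss's identity each of the four series over the multiples of one number
  is the inverse of a theta series.\<close>
theorem Rbar_series:
  assumes "coprime l m" "l > 0" "m > 0"
  shows "Abs_fps (\<lambda>n. int (Rbar l m n)) * theta 1 * theta (l * m) = theta l * theta m"
proof -
  let ?M = "\<lambda>k. {x::nat. 0 < x \<and> k dvd x}"
  let ?R = "{x. 0 < x \<and> \<not> l dvd x \<and> \<not> m dvd x}"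
  let ?G = overpart_series
  have R: "Abs_fps (\<lambda>n. int (Rbar l m n)) = ?G ?R"
  proof (rule fps_ext)
    fix n
    have "{(xs, S) \<in> overpartitions n. \<forall>x\<in>set xs. \<not> l dvd x \<and> \<not> m dvd x}
        = {(xs, S) \<in> overpartitions n. set xs \<subseteq> ?R}"
      by (auto simp: overpartitions_def partitions_def)
    then show "Abs_fps (\<lambda>n. int (Rbar l m n)) $ n = ?G ?R $ n"
      using card_overpartitions_parts_in[of ?R n] by (simp add: Rbar_def)
  qed
  have "?G (?M 1) = ?G ?R * ?G (?M l \<union> ?M m)"
    by (subst overpart_series_Un[symmetric]) (auto intro: arg_cong[of _ _ ?G])
  moreover have "?G (?M l \<union> ?M m) = ?G (?M l) * ?G (?M m - ?M (l * m))"
    using assms by (subst overpart_series_Un[symmetric])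
      (auto intro!: arg_cong[of _ _ ?G] simp: divides_mult dest: dvd_mult_left)
  moreover have "?G (?M m) = ?G (?M m - ?M (l * m)) * ?G (?M (l * m))"
    by (subst overpart_series_Un[symmetric])
      (auto intro!: arg_cong[of _ _ ?G] dest: dvd_mult_right)
  moreover have "theta 1 * ?G (?M 1) = 1" "theta l * ?G (?M l) = 1" "theta m * ?G (?M m) = 1"
    "theta (l * m) * ?G (?M (l * m)) = 1"
    by (rule theta_mult_overpart_series, simp add: assms)+
  ultimately show ?thesis unfolding R by algebra
qed

section \<open>The form b^2 + c^2 + 3 d^2 + 3 e^2\<close>

lemma card_eq_twice_by_involution:
  assumes "finite X" "\<And>x. x \<in> X \<Longrightarrow> f x \<in> X" "\<And>x. x \<in> X \<Longrightarrow> f (f x) = x"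
    and "\<And>x. x \<in> X \<Longrightarrow> P (f x) \<longleftrightarrow> \<not> P x"
  shows "card X = 2 * card {x \<in> X. P x}"
proof -
  have "bij_betw f {x \<in> X. P x} {x \<in> X. \<not> P x}"
    by (rule bij_betw_byWitness[where f' = f]) (use assms in auto)
  then have "card {x \<in> X. P x} = card {x \<in> X. \<not> P x}" by (rule bij_betw_same_card)
  moreover have "card X = card {x \<in> X. P x} + card {x \<in> X. \<not> P x}"
    using assms(1) by (subst card_Un_disjoint[symmetric]) (auto intro: arg_cong[of _ _ card])
  ultimately show ?thesis by simp
qed

text \<open>Multiplication of \<open>x + y \<surd>-3\<close> by the cube root of unity \<open>(-1 + \<surd>-3) / 2\<close>. It preserves the
  integers exactly when \<open>x + y\<close> is even.\<close>
definition eisenstein_rot :: "int \<Rightarrow> int \<Rightarrow> int \<times> int" where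
  "eisenstein_rot x y = ((- x - 3 * y) div 2, (x - y) div 2)"

lemma eisenstein_rot_eq: "eisenstein_rot (y + 2 * k) y = (- 2 * y - k, k)"
  by (simp add: eisenstein_rot_def)

lemma eisenstein_rot_properties:
  assumes "even (x + y)" "eisenstein_rot x y = (x', y')"
  shows "x'\<^sup>2 + 3 * y'\<^sup>2 = x\<^sup>2 + 3 * y\<^sup>2" "even (x' + y')"
    "case_prod eisenstein_rot (eisenstein_rot x' y') = (x, y)" "x' = x \<and> y' = y \<longleftrightarrow> x = 0 \<and> y = 0"
proof -
  obtain k where k: "x = y + 2 * k"
    using assms(1) by (metis add_diff_cancel_left' diff_add_cancel dvdE even_diff)
  then have xy': "x' = - 2 * y - k" "y' = k" using assms(2) eisenstein_rot_eq[of y k] by auto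
  show "x'\<^sup>2 + 3 * y'\<^sup>2 = x\<^sup>2 + 3 * y\<^sup>2" unfolding k xy' by algebra
  show "even (x' + y')" unfolding xy' by simp
  have "k + 2 * (- y - k) = - 2 * y - k" by simp
  from eisenstein_rot_eq[of k "- y - k", unfolded this]
  have "eisenstein_rot x' y' = (y - k, - y - k)" unfolding xy' by simp
  moreover have "eisenstein_rot (y - k) (- y - k) = (x, y)" using eisenstein_rot_eq[of "- y - k" y]
      unfolding k by (simp add: algebra_simps)
  ultimately show "case_prod eisenstein_rot (eisenstein_rot x' y') = (x, y)" by simp
  show "x' = x \<and> y' = y \<longleftrightarrow> x = 0 \<and> y = 0" unfolding k xy' by auto
qed

lemma square_mod_4: "\<exists>q. x\<^sup>2 = 4 * q + of_bool (odd x)" for x :: int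
proof (cases "even x")
  case True
  then obtain k where "x = 2 * k" by blast
  then have "x\<^sup>2 = 4 * k\<^sup>2" by algebra
  then show ?thesis using True by auto
next
  case False
  then obtain k where "x = 2 * k + 1" by (rule oddE)
  then have "x\<^sup>2 = 4 * (k\<^sup>2 + k) + 1" by algebra
  then show ?thesis using False by (intro exI[of _ "k\<^sup>2 + k"]) simp
qed

lemma square_mod_3: "\<exists>q. x\<^sup>2 = (if 3 dvd x then 9 * q else 3 * q + 1)" for x :: int
proof (cases "3 dvd x")
  case True
  then obtain k where "x = 3 * k" by blast
  then have "x\<^sup>2 = 9 * k\<^sup>2" by algebra
  then show ?thesis using True by auto
next
  case False
  then have "\<exists>k. x = 3 * k + 1 \<or> x = 3 * k - 1" by presburger
  then obtain k where "x = 3 * k + 1 \<or> x = 3 * k - 1" by blast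
  then have "x\<^sup>2 = 3 * (3 * k\<^sup>2 + 2 * k) + 1 \<or> x\<^sup>2 = 3 * (3 * k\<^sup>2 - 2 * k) + 1" by algebra
  then have "\<exists>q. x\<^sup>2 = 3 * q + 1" by blast
  then show ?thesis using False by simp
qed

lemma abs_le_if_square_le:
  fixes x m :: int
  assumes "x\<^sup>2 \<le> m"
  shows "x \<in> {- m..m}"
proof -
  have "\<bar>x\<bar> \<le> \<bar>x\<bar>\<^sup>2" by (cases "x = 0") (use self_le_power[of "\<bar>x\<bar>" 2] in simp_all)
  then show ?thesis using assms by auto
qed

definition quaternary_reps :: "int \<Rightarrow> (int \<times> int \<times> int \<times> int) set" where
  "quaternary_reps m = {(b, c, d, e). b\<^sup>2 + c\<^sup>2 + 3 * d\<^sup>2 + 3 * e\<^sup>2 = m}"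

definition binary_reps :: "int \<Rightarrow> (int \<times> int) set" where
  "binary_reps m = {(x, y). x\<^sup>2 + 3 * y\<^sup>2 = m}"

lemma finite_quaternary_reps: "finite (quaternary_reps m)"
proof (rule finite_subset)
  show "quaternary_reps m \<subseteq> {- m..m} \<times> {- m..m} \<times> {- m..m} \<times> {- m..m}"
  proof
    fix z assume "z \<in> quaternary_reps m"
    moreover obtain b c d e where z: "z = (b, c, d, e)" by (cases z)
    ultimately have "b\<^sup>2 + c\<^sup>2 + 3 * d\<^sup>2 + 3 * e\<^sup>2 = m" by (simp add: quaternary_reps_def)
    moreover have "b\<^sup>2 \<ge> 0" "c\<^sup>2 \<ge> 0" "d\<^sup>2 \<ge> 0" "e\<^sup>2 \<ge> 0" by simp_all
    ultimately have "b\<^sup>2 \<le> m" "c\<^sup>2 \<le> m" "d\<^sup>2 \<le> m" "e\<^sup>2 \<le> m" by linarith+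
    from this[THEN abs_le_if_square_le]
    show "z \<in> {- m..m} \<times> {- m..m} \<times> {- m..m} \<times> {- m..m}" unfolding z by blast
  qed
qed simp

lemma quaternary_parity:
  assumes "(b, c, d, e) \<in> quaternary_reps m"
  shows "even m \<longleftrightarrow> even (b + c + d + e)"
proof -
  have "even (b\<^sup>2 + c\<^sup>2 + 3 * d\<^sup>2 + 3 * e\<^sup>2) \<longleftrightarrow> even (b + c + d + e)" by simp
  moreover have "m = b\<^sup>2 + c\<^sup>2 + 3 * d\<^sup>2 + 3 * e\<^sup>2" using assms by (simp add: quaternary_reps_def)
  ultimately show ?thesis by (simp only:)
qed

text \<open>Odd squares are 1 and even squares 0 modulo 4, and the coefficient 3 is \<open>-1\<close>.\<close>
lemma quaternary_mod_4:
  assumes "(b, c, d, e) \<in> quaternary_reps m"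
  shows "4 dvd m - (of_bool (odd b) + of_bool (odd c) - of_bool (odd d) - of_bool (odd e))"
proof -
  obtain p q r s where "b\<^sup>2 = 4 * p + of_bool (odd b)" "c\<^sup>2 = 4 * q + of_bool (odd c)"
    "d\<^sup>2 = 4 * r + of_bool (odd d)" "e\<^sup>2 = 4 * s + of_bool (odd e)"
    using square_mod_4 by meson
  then have "m - (of_bool (odd b) + of_bool (odd c) - of_bool (odd d) - of_bool (odd e))
      = 4 * (p + q + 3 * r + 3 * s + of_bool (odd d) + of_bool (odd e))"
    using assms by (simp add: quaternary_reps_def)
  then show ?thesis by (metis dvd_triv_left)
qed

text \<open>When both pairs \<open>(b, d)\<close> and \<open>(c, e)\<close> can be rotated, rotating them simultaneously fixes only the
  origin.\<close>
lemma card_quaternary_same_parity_pairs: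
  "3 dvd int (card {(b, c, d, e) \<in> quaternary_reps m. even (b + d) \<and> even (c + e)}) - (if m = 0 then 1 else 0)"
proof -
  let ?X = "{(b, c, d, e) \<in> quaternary_reps m. even (b + d) \<and> even (c + e)}"
  let ?F = "{z \<in> ?X. z = (0, 0, 0, 0)}"
  define f where "f = (\<lambda>(b, c, d, e). (fst (eisenstein_rot b d), fst (eisenstein_rot c e),
      snd (eisenstein_rot b d), snd (eisenstein_rot c e)))"
  have *: "f z \<in> ?X \<and> f (f (f z)) = z \<and> (f z = z \<longleftrightarrow> z \<in> ?F)" if "z \<in> ?X" for z
  proof -
    obtain b c d e where z: "z = (b, c, d, e)" by (cases z)
    obtain b' d' where bd: "eisenstein_rot b d = (b', d')" by (cases "eisenstein_rot b d")
    obtain c' e' where ce: "eisenstein_rot c e = (c', e')" by (cases "eisenstein_rot c e")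
    have X: "(b, c, d, e) \<in> quaternary_reps m" "even (b + d)" "even (c + e)" using that z by auto
    note R = eisenstein_rot_properties[OF X(2) bd] eisenstein_rot_properties[OF X(3) ce]
    have fz: "f z = (b', c', d', e')" by (simp add: z f_def bd ce)
    have "f z \<in> ?X" using R X(1) unfolding fz quaternary_reps_def by auto
    moreover have "f (f (f z)) = z"
      unfolding fz using R(3,7) by (simp add: z f_def case_prod_beta)
    moreover have "f z = z \<longleftrightarrow> z \<in> ?F" unfolding fz unfolding z using R(4,8) X by auto
    ultimately show ?thesis by blast
  qed
  have "3 dvd int (card ?X) - int (card ?F)"
    by (rule card_eq_card_fixed_points_mod_3[OF _ _ *])
      (auto intro: finite_subset[OF _ finite_quaternary_reps])
  moreover have "?F = (if m = 0 then {(0, 0, 0, 0)} else {})"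
    by (auto simp: quaternary_reps_def)
  ultimately show ?thesis by (simp split: if_splits)
qed

text \<open>For odd \<open>m\<close> exactly one of the pairs \<open>(b, d)\<close> and \<open>(c, e)\<close> has an even sum; by symmetry take it to
  be \<open>(b, d)\<close>. The rotation of this pair fixes the solutions with \<open>b = d = 0\<close>.\<close>
lemma card_quaternary_odd:
  assumes "odd m"
  shows "3 dvd int (card (quaternary_reps m)) - 2 * int (card (binary_reps m))"
proof -
  let ?X = "{z \<in> quaternary_reps m. case z of (b, c, d, e) \<Rightarrow> even (b + d)}"
  define f where "f = (\<lambda>(b, c::int, d, e::int). (fst (eisenstein_rot b d), c, snd (eisenstein_rot b d), e))"
  have *: "f z \<in> ?X \<and> f (f (f z)) = z \<and> (f z = z
      \<longleftrightarrow> z \<in> (\<lambda>(c, e). (0, c, 0, e)) ` binary_reps m)"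
    if "z \<in> ?X" for z
  proof -
    obtain b c d e where z: "z = (b, c, d, e)" by (cases z)
    obtain b' d' where bd: "eisenstein_rot b d = (b', d')" by (cases "eisenstein_rot b d")
    have X: "(b, c, d, e) \<in> quaternary_reps m" "even (b + d)" using that z by auto
    note R = eisenstein_rot_properties[OF X(2) bd]
    have fz: "f z = (b', c, d', e)" by (simp add: z f_def bd)
    have "f z \<in> ?X" using R X(1) unfolding fz quaternary_reps_def by auto
    moreover have "f (f (f z)) = z"
      unfolding fz using R(3) by (simp add: z f_def case_prod_beta)
    moreover have "f z = z \<longleftrightarrow> z \<in> (\<lambda>(c, e). (0, c, 0, e)) ` binary_reps m"
      unfolding fz unfolding z using R(4) X(1) by (auto simp: quaternary_reps_def binary_reps_def)
    ultimately show ?thesis by blast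
  qed
  have "3 dvd int (card ?X) - int (card ((\<lambda>(c, e). (0::int, c, 0::int, e)) ` binary_reps m))"
  proof (rule card_eq_card_fixed_points_mod_3[OF _ _ *])
    show "finite ?X" by (rule finite_subset[OF _ finite_quaternary_reps]) auto
    show "(\<lambda>(c, e). (0, c, 0, e)) ` binary_reps m \<subseteq> ?X" by (auto simp: quaternary_reps_def binary_reps_def)
  qed
  moreover have "card ((\<lambda>(c, e). (0::int, c, 0::int, e)) ` binary_reps m) = card (binary_reps m)"
    by (rule card_image) (auto simp: inj_on_def)
  moreover have "card (quaternary_reps m) = 2 * card ?X"
  proof (rule card_eq_twice_by_involution[where f = "\<lambda>(b, c, d, e). (c, b, e, d)"])
    fix z assume "z \<in> quaternary_reps m"
    moreover obtain b c d e where z: "z = (b, c, d, e)" by (cases z)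
    ultimately have "odd (b + c + d + e)" using assms quaternary_parity by blast
    then show "(case (case z of (b, c, d, e) \<Rightarrow> (c, b, e, d)) of (b, c, d, e) \<Rightarrow> even (b + d))
        \<longleftrightarrow> \<not> (case z of (b, c, d, e) \<Rightarrow> even (b + d))"
      unfolding z prod.case by presburger
  qed (use finite_quaternary_reps in \<open>auto simp: quaternary_reps_def\<close>)
  ultimately show ?thesis by presburger
qed

text \<open>Twice a sum of two squares is \<open>(u + v)\<^sup>2 + (u - v)\<^sup>2\<close>. Conversely, as \<open>2 * k\<close> is 2 modulo 4, every
  representation of it has \<open>b\<close> congruent to \<open>c\<close> and \<open>d\<close> congruent to \<open>e\<close> modulo 2.\<close>
lemma card_quaternary_double:
  assumes "odd k"
  shows "card (quaternary_reps (2 * k)) = card (quaternary_reps k)"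
proof (rule bij_betw_same_card[symmetric])
  have par: "even (b + c)" "even (d + e)" if "(b, c, d, e) \<in> quaternary_reps (2 * k)" for b c d e
    using quaternary_mod_4[OF that] assms
    by (cases "even b"; cases "even c"; cases "even d"; cases "even e"; simp; presburger)+
  show "bij_betw (\<lambda>(b, c, d, e). (b + c, b - c, d + e, d - e)) (quaternary_reps k) (quaternary_reps (2 * k))"
  proof (rule bij_betw_byWitness[where
        f' = "\<lambda>(b, c, d, e). ((b + c) div 2, (b - c) div 2, (d + e) div 2, (d - e) div 2)"])
    have half: "\<exists>u v. b = u + v \<and> c = u - v" if "even (b + c)" for b c :: int
      using that by (intro exI[of _ "(b + c) div 2"] exI[of _ "(b - c) div 2"]) presburger
    have q: "(u + v)\<^sup>2 + (u - v)\<^sup>2 + 3 * (s + t)\<^sup>2 + 3 * (s - t)\<^sup>2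
        = 2 * (u\<^sup>2 + v\<^sup>2 + 3 * s\<^sup>2 + 3 * t\<^sup>2)" for u v s t :: int
      by algebra
    show "(\<lambda>(b, c, d, e). (b + c, b - c, d + e, d - e)) ` quaternary_reps k \<subseteq> quaternary_reps (2 * k)"
      by (auto simp: quaternary_reps_def q)
    show "\<forall>z\<in>quaternary_reps (2 * k). (case (case z of (b, c, d, e) \<Rightarrow>
        ((b + c) div 2, (b - c) div 2, (d + e) div 2, (d - e) div 2)) of
        (b, c, d, e) \<Rightarrow> (b + c, b - c, d + e, d - e)) = z"
    proof
      fix z assume z: "z \<in> quaternary_reps (2 * k)"
      obtain b c d e where [simp]: "z = (b, c, d, e)" by (cases z)
      obtain u v s t where "b = u + v" "c = u - v" "d = s + t" "e = s - t"
        using par z half by (metis \<open>z = (b, c, d, e)\<close>)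
      then show "(case (case z of (b, c, d, e) \<Rightarrow>
          ((b + c) div 2, (b - c) div 2, (d + e) div 2, (d - e) div 2)) of
          (b, c, d, e) \<Rightarrow> (b + c, b - c, d + e, d - e)) = z" by simp
    qed
    show "(\<lambda>(b, c, d, e). ((b + c) div 2, (b - c) div 2, (d + e) div 2, (d - e) div 2)) ` quaternary_reps (2 * k)
        \<subseteq> quaternary_reps k"
    proof clarify
      fix b c d e assume z: "(b, c, d, e) \<in> quaternary_reps (2 * k)"
      obtain u v s t where "b = u + v" "c = u - v" "d = s + t" "e = s - t"
        using par[OF z] half by metis
      then show "((b + c) div 2, (b - c) div 2, (d + e) div 2, (d - e) div 2) \<in> quaternary_reps k"
        using z by (simp add: quaternary_reps_def q)
    qed
  qed auto
qed

text \<open>The left side counts solutions for which neither pair can be rotated. Modulo 4 such a solution has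
  \<open>b\<close> and \<open>e\<close> of one parity, \<open>c\<close> and \<open>d\<close> of the other. Exchanging the roles of the pairs makes
  \<open>b\<close> and \<open>e\<close> odd, and the sign of \<open>e\<close> can be chosen such that 4 divides \<open>b + e\<close>: this is the
  factor 4. The remaining solutions have the form \<open>c = 2 z\<close>, \<open>d = 2 t\<close> and
  \<open>b + e \<surd>-3 = (-1 + \<surd>-3) (x + y \<surd>-3)\<close> with \<open>x + y\<close> odd.\<close>
lemma card_quaternary_quadruple_mixed:
  "card {(b, c, d, e) \<in> quaternary_reps (4 * k). odd (b + d)}
      = 4 * card {(b, c, d, e) \<in> quaternary_reps k. odd (b + d)}"
proof -
  let ?D = "{(b, c, d, e) \<in> quaternary_reps (4 * k). odd (b + d)}"
  let ?D1 = "{z \<in> ?D. case z of (b, c, d, e) \<Rightarrow> odd b}"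
  let ?D2 = "{z \<in> ?D1. case z of (b, c, d, e) \<Rightarrow> 4 dvd b + e}"
  have par: "odd (b + d) \<Longrightarrow> even (b + e) \<and> even (c + d)"
      if "(b, c, d, e) \<in> quaternary_reps (4 * k)" for b c d e
    using quaternary_mod_4[OF that]
    by (cases "even b"; cases "even c"; cases "even d"; cases "even e"; simp; presburger)
  have fin: "finite ?D" by (rule finite_subset[OF _ finite_quaternary_reps]) auto
  have "card ?D = 2 * card ?D1"
  proof (rule card_eq_twice_by_involution[where f = "\<lambda>(b, c, d, e). (c, b, e, d)"])
    show "(case z of (b, c, d, e) \<Rightarrow> (c, b, e, d)) \<in> ?D" if "z \<in> ?D" for z
    proof -
      obtain b c d e where z: "z = (b, c, d, e)" by (cases z)
      have "(b, c, d, e) \<in> quaternary_reps (4 * k)" "odd (b + d)" "even (c + d)" "even (b + e)"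
        using that par unfolding z by blast+
      moreover from this have "odd (c + e)" by presburger
      ultimately show ?thesis unfolding z by (simp add: quaternary_reps_def)
    qed
    show "(case (case z of (b, c, d, e) \<Rightarrow> (c, b, e, d)) of (b, c, d, e) \<Rightarrow> odd b)
        \<longleftrightarrow> \<not> (case z of (b, c, d, e) \<Rightarrow> odd b)" if "z \<in> ?D" for z
    proof -
      obtain b c d e where z: "z = (b, c, d, e)" by (cases z)
      have "odd (b + d)" "even (c + d)" using that par unfolding z by blast+
      then show ?thesis unfolding z prod.case by presburger
    qed
  qed (use fin in auto)
  moreover have "card ?D1 = 2 * card ?D2"
  proof (rule card_eq_twice_by_involution[where f = "\<lambda>(b, c, d, e). (b, c, d, - e)"])
    show "(case (case z of (b, c, d, e) \<Rightarrow> (b, c, d, - e)) of (b, c, d, e) \<Rightarrow> 4 dvd b + e)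
        \<longleftrightarrow> \<not> (case z of (b, c, d, e) \<Rightarrow> 4 dvd b + e)" if "z \<in> ?D1" for z
    proof -
      obtain b c d e where z: "z = (b, c, d, e)" by (cases z)
      then have "odd b" "even (b + e)" using that par by blast+
      then show ?thesis unfolding z prod.case by presburger
    qed
  qed (use fin in \<open>auto simp: quaternary_reps_def\<close>)
  moreover have "bij_betw (\<lambda>(x, z, y, t). (- x - 3 * y, 2 * z, 2 * t, x - y))
      {(b, c, d, e) \<in> quaternary_reps k. odd (b + d)} ?D2"
  proof (rule bij_betw_byWitness[where
        f' = "\<lambda>(b, c, d, e). (e - (b + e) div 4, c div 2, - ((b + e) div 4), d div 2)"])
    have q: "(- x - 3 * y)\<^sup>2 + 3 * (x - y)\<^sup>2 = 4 * x\<^sup>2 + 12 * y\<^sup>2" for x y :: int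
      by algebra
    have inv: "\<exists>x y z t. b = - x - 3 * y \<and> c = 2 * z \<and> d = 2 * t \<and> e = x - y \<and> odd (x + y)"
      if "(b, c, d, e) \<in> ?D2" for b c d e
    proof -
      have "odd b" "odd (b + d)" "even (c + d)" "4 dvd b + e" using that par by blast+
      then have "even c" "even d" by presburger+
      then obtain y z t where yzt: "b + e = 4 * y" "c = 2 * z" "d = 2 * t" using \<open>4 dvd b + e\<close> by (metis dvdE)
      have "b = - (e - y) - 3 * (- y)" "e = (e - y) - (- y)" "odd ((e - y) + (- y))"
        using yzt(1) \<open>odd b\<close> by presburger+
      then show ?thesis using yzt by blast
    qed
    show "\<forall>w\<in>{(b, c, d, e) \<in> quaternary_reps k. odd (b + d)}.
        (case (case w of (x, z, y, t) \<Rightarrow> (- x - 3 * y, 2 * z, 2 * t, x - y)) of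
         (b, c, d, e) \<Rightarrow> (e - (b + e) div 4, c div 2, - ((b + e) div 4), d div 2)) = w"
      by auto
    show "\<forall>w\<in>?D2. (case (case w of (b, c, d, e) \<Rightarrow>
          (e - (b + e) div 4, c div 2, - ((b + e) div 4), d div 2)) of
        (x, z, y, t) \<Rightarrow> (- x - 3 * y, 2 * z, 2 * t, x - y)) = w"
    proof
      fix w assume w: "w \<in> ?D2"
      obtain b c d e where [simp]: "w = (b, c, d, e)" by (cases w)
      obtain x y z t where "b = - x - 3 * y" "c = 2 * z" "d = 2 * t" "e = x - y"
        using inv[of b c d e] w \<open>w = (b, c, d, e)\<close> by blast
      then show "(case (case w of (b, c, d, e) \<Rightarrow>
          (e - (b + e) div 4, c div 2, - ((b + e) div 4), d div 2)) of
        (x, z, y, t) \<Rightarrow> (- x - 3 * y, 2 * z, 2 * t, x - y)) = w" by simp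
    qed
    show "(\<lambda>(x, z, y, t). (- x - 3 * y, 2 * z, 2 * t, x - y))
        ` {(b, c, d, e) \<in> quaternary_reps k. odd (b + d)} \<subseteq> ?D2"
      by (auto simp: quaternary_reps_def q)
    show "(\<lambda>(b, c, d, e). (e - (b + e) div 4, c div 2, - ((b + e) div 4), d div 2)) ` ?D2
        \<subseteq> {(b, c, d, e) \<in> quaternary_reps k. odd (b + d)}"
    proof (rule image_subsetI)
      fix w assume w: "w \<in> ?D2"
      obtain b c d e where [simp]: "w = (b, c, d, e)" by (cases w)
      obtain x y z t where xyzt: "b = - x - 3 * y" "c = 2 * z" "d = 2 * t" "e = x - y" "odd (x + y)"
        using inv[of b c d e] w \<open>w = (b, c, d, e)\<close> by blast
      have "b + e = 4 * (- y)" using xyzt by simp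
      then have "(b + e) div 4 = - y" by (metis nonzero_mult_div_cancel_left zero_neq_numeral)
      then have "(case w of (b, c, d, e) \<Rightarrow> (e - (b + e) div 4, c div 2, - ((b + e) div 4), d div 2))
          = (x, z, y, t)" using xyzt by simp
      moreover have "(x, z, y, t) \<in> quaternary_reps k" using w xyzt q[of x y] by (simp add: quaternary_reps_def)
      ultimately show "(case w of (b, c, d, e) \<Rightarrow> (e - (b + e) div 4, c div 2, - ((b + e) div 4), d div 2))
          \<in> {(b, c, d, e) \<in> quaternary_reps k. odd (b + d)}"
        using xyzt(5) by simp
    qed
  qed
  from bij_betw_same_card[OF this]
  have "card {(b, c, d, e) \<in> quaternary_reps k. odd (b + d)} = card ?D2" .
  ultimately show ?thesis by simp
qed

text \<open>Let \<open>A m\<close> count the solutions in which both pairs can be rotated and \<open>C m\<close> those in which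
  \<open>(b, d)\<close> cannot. For even \<open>m\<close> all solutions are of one of these kinds, and \<open>A m\<close> is 0 or 1 modulo
  3 according to whether \<open>m \<noteq> 0\<close>. As \<open>C (4 k) = 4 C k\<close>, the case of even \<open>k\<close> follows. For odd
  \<open>k\<close> exactly one pair cannot be rotated, so \<open>C k\<close> is half of all solutions, and
  \<open>4 / 2\<close> is \<open>-1\<close> modulo 3.\<close>
lemma card_quaternary_quadruple:
  "3 dvd int (card (quaternary_reps (4 * k))) - parity_sign k * int (card (quaternary_reps k))"
proof -
  let ?A = "\<lambda>m. int (card {(b, c, d, e) \<in> quaternary_reps m. even (b + d) \<and> even (c + e)})"
  let ?C = "\<lambda>m. int (card {(b, c, d, e) \<in> quaternary_reps m. odd (b + d)})"
  have split: "int (card (quaternary_reps m)) = ?A m + ?C m" if "even m" for m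
  proof -
    have "even (c + e)" if "(b, c, d, e) \<in> quaternary_reps m" "even (b + d)" for b c d e
      using quaternary_parity[OF that(1)] that(2) \<open>even m\<close> by presburger
    then have eq: "quaternary_reps m = {(b, c, d, e) \<in> quaternary_reps m. even (b + d) \<and> even (c + e)}
        \<union> {(b, c, d, e) \<in> quaternary_reps m. odd (b + d)}"
      (is "_ = ?L \<union> ?R") by auto
    have "card (quaternary_reps m) = card ?L + card ?R"
      by (rule trans[OF arg_cong[OF eq, of card] card_Un_disjoint])
        (auto intro: finite_subset[OF _ finite_quaternary_reps])
    then show ?thesis by simp
  qed
  have four: "?C (4 * k) = 4 * ?C k" using card_quaternary_quadruple_mixed[of k] by simp
  show ?thesis
  proof (cases "even k")
    case True
    then show ?thesis
      using split[of k] split[of "4 * k"] four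
          card_quaternary_same_parity_pairs[of k] card_quaternary_same_parity_pairs[of "4 * k"]
      by (simp add: parity_sign_def split: if_splits; presburger)
  next
    case False
    have "card (quaternary_reps k) = 2 * card {z \<in> quaternary_reps k. case z of (b, c, d, e) \<Rightarrow> odd (b + d)}"
    proof (rule card_eq_twice_by_involution[where f = "\<lambda>(b, c, d, e). (c, b, e, d)"])
      fix z assume "z \<in> quaternary_reps k"
      moreover obtain b c d e where z: "z = (b, c, d, e)" by (cases z)
      ultimately have "odd (b + c + d + e)" using False quaternary_parity by blast
      then show "(case (case z of (b, c, d, e) \<Rightarrow> (c, b, e, d)) of (b, c, d, e) \<Rightarrow> odd (b + d))
          \<longleftrightarrow> \<not> (case z of (b, c, d, e) \<Rightarrow> odd (b + d))"
        unfolding z prod.case by presburger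
    qed (use finite_quaternary_reps in \<open>auto simp: quaternary_reps_def\<close>)
    moreover have "{z \<in> quaternary_reps k. case z of (b, c, d, e) \<Rightarrow> odd (b + d)}
        = {(b, c, d, e) \<in> quaternary_reps k. odd (b + d)}" by auto
    ultimately have "int (card (quaternary_reps k)) = 2 * ?C k" by simp
    then show ?thesis
      using False split[of "4 * k"] four card_quaternary_same_parity_pairs[of "4 * k"]
      by (simp add: parity_sign_def split: if_splits; presburger)
  qed
qed

section \<open>Signed sums over one more variable\<close>

lemma three_dvd_sum_of_two_squares:
  fixes x y z :: int
  assumes "3 dvd x\<^sup>2 + y\<^sup>2"
  shows "3 dvd x \<and> 3 dvd y"
proof -
  obtain p q where "x\<^sup>2 = (if 3 dvd x then 9 * p else 3 * p + 1)" "y\<^sup>2 = (if 3 dvd y then 9 * q else 3 * q + 1)"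
    using square_mod_3 by meson
  then show ?thesis using assms by (cases "3 dvd x"; cases "3 dvd y"; simp; presburger)
qed

lemma not_two_mod_3_square: "x\<^sup>2 \<noteq> 3 * j + 2" for x j :: int
proof -
  obtain p where "x\<^sup>2 = (if 3 dvd x then 9 * p else 3 * p + 1)"
    using square_mod_3 by meson
  then show ?thesis by (cases "3 dvd x"; simp; presburger)
qed

definition ternary_reps :: "int \<Rightarrow> (int \<times> int \<times> int) set" where
  "ternary_reps m = {(a, v, t). 2 * a\<^sup>2 + v\<^sup>2 + 3 * t\<^sup>2 = m}"

lemma finite_ternary_reps: "finite (ternary_reps m)"
proof (rule finite_subset)
  show "ternary_reps m \<subseteq> {- m..m} \<times> {- m..m} \<times> {- m..m}"
  proof
    fix z assume "z \<in> ternary_reps m"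
    moreover obtain a v t where z: "z = (a, v, t)" by (cases z)
    ultimately have "2 * a\<^sup>2 + v\<^sup>2 + 3 * t\<^sup>2 = m" by (simp add: ternary_reps_def)
    moreover have "a\<^sup>2 \<ge> 0" "v\<^sup>2 \<ge> 0" "t\<^sup>2 \<ge> 0" by simp_all
    ultimately have "a\<^sup>2 \<le> m" "v\<^sup>2 \<le> m" "t\<^sup>2 \<le> m" by linarith+
    from this[THEN abs_le_if_square_le]
    show "z \<in> {- m..m} \<times> {- m..m} \<times> {- m..m}" unfolding z by blast
  qed
qed simp

text \<open>By a look at the equation modulo 9, neither \<open>a\<close> nor \<open>v\<close> is divisible by 3 and \<open>3\<close> divides \<open>v\<^sup>2 + 2 a\<^sup>2\<close>, so up to the sign of
  \<open>a\<close> the number \<open>v + a \<surd>-2\<close> is a multiple \<open>(1 + \<surd>-2) (w + z \<surd>-2)\<close>, that is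
  \<open>v = w - 2 z\<close> and \<open>a = w + z\<close>. The equation becomes \<open>3 (w\<^sup>2 + 2 z\<^sup>2 + t\<^sup>2) = m\<close>. Exchanging \<open>w\<close> and
  \<open>t\<close> is an involution; it changes the parity of \<open>a\<close> because \<open>w + t\<close> is odd for odd \<open>m\<close>.\<close>
lemma signed_ternary_sum_zero:
  assumes "odd m" "m mod 9 = 6"
  shows "(\<Sum>z\<in>ternary_reps m. parity_sign (fst z)) = 0"
proof -
  let ?P = "{z \<in> ternary_reps m. 3 dvd fst z - fst (snd z)}"
  let ?N = "{z \<in> ternary_reps m. \<not> 3 dvd fst z - fst (snd z)}"
  have exact: "3 dvd a - v \<longleftrightarrow> \<not> 3 dvd a + v" if "(a, v, t) \<in> ternary_reps m" for a v t
  proof -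
    obtain p q where pq: "a\<^sup>2 = (if 3 dvd a then 9 * p else 3 * p + 1)"
      "v\<^sup>2 = (if 3 dvd v then 9 * q else 3 * q + 1)"
      using square_mod_3 by meson
    have "m = 9 * (m div 9) + 6" using assms(2) by presburger
    then have m: "2 * a\<^sup>2 + v\<^sup>2 + 3 * t\<^sup>2 = 9 * (m div 9) + 6"
      using that by (simp add: ternary_reps_def)
    have "\<not> 3 dvd a \<and> \<not> 3 dvd v"
    proof (rule ccontr)
      assume "\<not> (\<not> 3 dvd a \<and> \<not> 3 dvd v)"
      moreover have "3 dvd a \<longleftrightarrow> 3 dvd v"
        using pq m by (cases "3 dvd a"; cases "3 dvd v"; simp; presburger)
      ultimately have "18 * p + 9 * q + 3 * t\<^sup>2 = 9 * (m div 9) + 6" using pq m by simp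
      then have "t\<^sup>2 = 3 * (m div 9 - 2 * p - q) + 2" by simp
      then show False using not_two_mod_3_square by blast
    qed
    then show ?thesis by presburger
  qed
  have neg: "(- a, v, t) \<in> ternary_reps m \<longleftrightarrow> (a, v, t) \<in> ternary_reps m" for a v t
    by (simp add: ternary_reps_def)
  \<comment> \<open>On \<open>?P\<close> one has \<open>w = a - z\<close> with the integer \<open>z = (a - v) / 3\<close>; \<open>\<sigma>\<close> exchanges \<open>w\<close> and \<open>t\<close>.\<close>
  define \<sigma> where "\<sigma> = (\<lambda>(a::int, v, t). let z = (a - v) div 3 in (t + z, t - 2 * z, a - z))"
  have \<sigma>: "\<sigma> y \<in> ?P \<and> \<sigma> (\<sigma> y) = y \<and> parity_sign (fst (\<sigma> y)) = - parity_sign (fst y)"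
      if "y \<in> ?P" for y
  proof -
    obtain a v t where y: "y = (a, v, t)" by (cases y)
    have in_tern: "(a, v, t) \<in> ternary_reps m" and "3 dvd a - v" using that unfolding y by simp_all
    then obtain z where "a - v = 3 * z" by blast
    then have v: "v = a - 3 * z" by simp
    have \<sigma>y: "\<sigma> y = (t + z, t - 2 * z, a - z)" unfolding y v by (simp add: \<sigma>_def Let_def)
    have norm: "2 * (t + z)\<^sup>2 + (t - 2 * z)\<^sup>2 + 3 * (a - z)\<^sup>2 = 2 * a\<^sup>2 + (a - 3 * z)\<^sup>2 + 3 * t\<^sup>2"
      by algebra
    have "\<sigma> y \<in> ?P"
      using in_tern norm unfolding \<sigma>y v by (simp add: ternary_reps_def)
    moreover have "\<sigma> (\<sigma> y) = y"
      unfolding \<sigma>y y v by (simp add: \<sigma>_def Let_def)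
    moreover have "parity_sign (fst (\<sigma> y)) = - parity_sign (fst y)"
    proof -
      have "odd (2 * a\<^sup>2 + (a - 3 * z)\<^sup>2 + 3 * t\<^sup>2)"
        using in_tern assms(1) unfolding v by (simp add: ternary_reps_def)
      then show ?thesis unfolding \<sigma>y unfolding y by (auto simp: parity_sign_def)
    qed
    ultimately show ?thesis by blast
  qed
  have "bij_betw \<sigma> ?P ?P"
    by (rule bij_betw_byWitness[where f' = \<sigma>]) (use \<sigma> in blast)+
  from sum.reindex_bij_betw[OF this, of "\<lambda>z. parity_sign (fst z)"]
  have "(\<Sum>z\<in>?P. parity_sign (fst z)) = (\<Sum>z\<in>?P. parity_sign (fst (\<sigma> z)))" by simp
  also have "\<dots> = (\<Sum>z\<in>?P. - parity_sign (fst z))"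
    by (rule sum.cong[OF refl]) (use \<sigma> in blast)
  also have "\<dots> = - (\<Sum>z\<in>?P. parity_sign (fst z))" by (rule sum_negf)
  finally have P0: "(\<Sum>z\<in>?P. parity_sign (fst z)) = 0" by simp
  have "bij_betw (\<lambda>(a, v, t). (- a, v, t)) ?P ?N"
  proof (rule bij_betw_byWitness[where f' = "\<lambda>(a, v, t). (- a, v, t)"])
    have minus: "3 dvd - a - v \<longleftrightarrow> 3 dvd a + v" for a v :: int by presburger
    show "(\<lambda>(a, v, t). (- a, v, t)) ` ?P \<subseteq> ?N" "(\<lambda>(a, v, t). (- a, v, t)) ` ?N \<subseteq> ?P"
      using exact by (auto simp: neg minus)
  qed auto
  from sum.reindex_bij_betw[OF this, of "\<lambda>z. parity_sign (fst z)"]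
  have "(\<Sum>z\<in>?N. parity_sign (fst z)) = (\<Sum>z\<in>?P. parity_sign (fst z))"
    by (simp add: case_prod_beta parity_sign_def)
  moreover have "(\<Sum>z\<in>ternary_reps m. parity_sign (fst z))
      = (\<Sum>z\<in>?P. parity_sign (fst z)) + (\<Sum>z\<in>?N. parity_sign (fst z))"
    by (subst sum.union_disjoint[symmetric]) (auto simp: finite_ternary_reps intro: sum.cong)
  ultimately show ?thesis using P0 by simp
qed

definition quinary_reps :: "int \<Rightarrow> (int \<times> int \<times> int \<times> int \<times> int) set" where
  "quinary_reps m = {(a, b, c, d, e). a\<^sup>2 + b\<^sup>2 + c\<^sup>2 + 3 * d\<^sup>2 + 3 * e\<^sup>2 = m}"

lemma finite_quinary_reps: "finite (quinary_reps m)"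
proof (rule finite_subset)
  show "quinary_reps m \<subseteq> {- m..m} \<times> {- m..m} \<times> {- m..m} \<times> {- m..m} \<times> {- m..m}"
  proof
    fix z assume "z \<in> quinary_reps m"
    moreover obtain a b c d e where z: "z = (a, b, c, d, e)" by (cases z)
    ultimately have "a\<^sup>2 + b\<^sup>2 + c\<^sup>2 + 3 * d\<^sup>2 + 3 * e\<^sup>2 = m" by (simp add: quinary_reps_def)
    moreover have "a\<^sup>2 \<ge> 0" "b\<^sup>2 \<ge> 0" "c\<^sup>2 \<ge> 0" "d\<^sup>2 \<ge> 0" "e\<^sup>2 \<ge> 0" by simp_all
    ultimately have "a\<^sup>2 \<le> m" "b\<^sup>2 \<le> m" "c\<^sup>2 \<le> m" "d\<^sup>2 \<le> m" "e\<^sup>2 \<le> m" by linarith+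
    from this[THEN abs_le_if_square_le]
    show "z \<in> {- m..m} \<times> {- m..m} \<times> {- m..m} \<times> {- m..m} \<times> {- m..m}" unfolding z by blast
  qed
qed simp

text \<open>Cyclic permutation of \<open>a, b, c\<close> leaves the solutions of \<open>3 a\<^sup>2 + 3 d\<^sup>2 + 3 e\<^sup>2 = m\<close>, and cyclic
  permutation of \<open>a, d, e\<close> then leaves those of \<open>9 a\<^sup>2 = m\<close>.\<close>
lemma card_quinary_mod_3:
  assumes "\<not> 9 dvd m"
  shows "3 dvd int (card (quinary_reps m))"
proof -
  let ?F = "{(a, b, c, d, e) \<in> quinary_reps m. a = b \<and> b = c}"
  have "3 dvd int (card (quinary_reps m)) - int (card ?F)"
    by (rule card_eq_card_fixed_points_mod_3[where f = "\<lambda>(a, b, c, d, e). (b, c, a, d, e)"])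
      (use finite_quinary_reps in \<open>auto simp: quinary_reps_def\<close>)
  moreover have "3 dvd int (card ?F) - int (card ({} :: (int \<times> int \<times> int \<times> int \<times> int) set))"
  proof (rule card_eq_card_fixed_points_mod_3[where f = "\<lambda>(a, b, c, d, e). (d, d, d, e, a)"])
    show "finite ?F" by (rule finite_subset[OF _ finite_quinary_reps]) auto
    fix z assume z: "z \<in> ?F"
    then obtain a d e where zade: "z = (a, a, a, d, e)" by auto
    have eq: "3 * a\<^sup>2 + 3 * d\<^sup>2 + 3 * e\<^sup>2 = m" using z unfolding zade by (simp add: quinary_reps_def)
    have "\<not> (a = d \<and> d = e)"
    proof
      assume "a = d \<and> d = e"
      then have "m = 9 * a\<^sup>2" using eq by simp
      then show False using assms by simp
    qed
    then show "(case z of (a, b, c, d, e) \<Rightarrow> (d, d, d, e, a)) \<in> ?F \<and>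
        (case (case (case z of (a, b, c, d, e) \<Rightarrow> (d, d, d, e, a)) of (a, b, c, d, e) \<Rightarrow> (d, d, d, e, a))
          of (a, b, c, d, e) \<Rightarrow> (d, d, d, e, a)) = z \<and>
        ((case z of (a, b, c, d, e) \<Rightarrow> (d, d, d, e, a)) = z \<longleftrightarrow> z \<in> {})"
      using eq unfolding zade by (auto simp: quinary_reps_def)
  qed simp
  ultimately show ?thesis by (simp only: card.empty of_nat_0) presburger
qed

text \<open>Up to the sign \<open>(-1)\<^sup>n\<close> this is the coefficient of \<open>q\<^sup>n\<close> in \<open>\<theta>\<^sub>4 \<theta>\<^sub>1\<^sup>2 \<theta>\<^sub>3\<^sup>2\<close>. Outside the range of
  summation the argument \<open>n - 4 a\<^sup>2\<close> is negative and not represented.\<close>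
definition signed_count :: "int \<Rightarrow> int" where
  "signed_count n = (\<Sum>a\<in>{- n..n}. parity_sign a * int (card (quaternary_reps (n - 4 * a\<^sup>2))))"

text \<open>The odd rule leaves the solutions of \<open>4 a\<^sup>2 + x\<^sup>2 + 3 y\<^sup>2 = n\<close>. Since 3 divides \<open>n\<close>, it divides \<open>a\<close>
  and \<open>x\<close>, and then \<open>3 y\<^sup>2\<close> would be 6 modulo 9.\<close>
lemma signed_count_15_mod_18:
  assumes "n mod 18 = 15"
  shows "3 dvd signed_count n"
  unfolding signed_count_def
proof (rule dvd_sum)
  fix a assume "a \<in> {- n..n}"
  have n: "n = 18 * (n div 18) + 15" using assms by presburger
  have "binary_reps (n - 4 * a\<^sup>2) = {}"
  proof -
    have False if "x\<^sup>2 + 3 * y\<^sup>2 = n - 4 * a\<^sup>2" for x y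
    proof -
      have "x\<^sup>2 + a\<^sup>2 = 3 * (6 * (n div 18) + 5 - a\<^sup>2 - y\<^sup>2)" using that n by simp
      then have "3 dvd x\<^sup>2 + a\<^sup>2" by (metis dvd_triv_left)
      then have "3 dvd x" "3 dvd a" using three_dvd_sum_of_two_squares by blast+
      then obtain x' a' where "x = 3 * x'" "a = 3 * a'" by (metis dvdE)
      then have "y\<^sup>2 = 3 * (2 * (n div 18) + 1 - x'\<^sup>2 - 4 * a'\<^sup>2) + 2"
        using that n by (simp add: power_mult_distrib)
      then show False using not_two_mod_3_square by blast
    qed
    then show ?thesis by (auto simp: binary_reps_def)
  qed
  moreover have "odd n" using assms by presburger
  then have "odd (n - 4 * a\<^sup>2)" by simp
  ultimately have "3 dvd int (card (quaternary_reps (n - 4 * a\<^sup>2)))" using card_quaternary_odd by fastforce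
  then show "3 dvd parity_sign a * int (card (quaternary_reps (n - 4 * a\<^sup>2)))" by (rule dvd_mult)
qed

text \<open>The doubling rule and then the odd rule turn the signed count into twice the signed sum over the
  solutions of \<open>2 a\<^sup>2 + v\<^sup>2 + 3 t\<^sup>2 = m\<close>.\<close>
lemma signed_count_double:
  assumes "odd m" "m mod 9 = 6"
  shows "3 dvd signed_count (2 * m)"
proof -
  let ?I = "{- (2 * m)..2 * m}"
  have "signed_count (2 * m) = (\<Sum>a\<in>?I. parity_sign a * int (card (quaternary_reps (m - 2 * a\<^sup>2))))"
  proof -
    have "card (quaternary_reps (2 * m - 4 * a\<^sup>2)) = card (quaternary_reps (m - 2 * a\<^sup>2))" for a
      using card_quaternary_double[of "m - 2 * a\<^sup>2"] assms(1) by (simp add: algebra_simps)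
    then show ?thesis by (simp add: signed_count_def)
  qed
  moreover have "3 dvd (\<Sum>a\<in>?I. parity_sign a * (int (card (quaternary_reps (m - 2 * a\<^sup>2)))
      - 2 * int (card (binary_reps (m - 2 * a\<^sup>2)))))"
    using assms(1) by (intro dvd_sum dvd_mult card_quaternary_odd) simp
  moreover have "(\<Sum>a\<in>?I. parity_sign a * int (card (binary_reps (m - 2 * a\<^sup>2)))) = 0"
  proof -
    have "fst ` ternary_reps m \<subseteq> ?I"
    proof
      fix a assume "a \<in> fst ` ternary_reps m"
      then obtain v t where "2 * a\<^sup>2 + v\<^sup>2 + 3 * t\<^sup>2 = m" by (auto simp: ternary_reps_def)
      moreover have "v\<^sup>2 \<ge> 0" "t\<^sup>2 \<ge> 0" "a\<^sup>2 \<ge> 0" by simp_all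
      ultimately have "a\<^sup>2 \<le> 2 * m" by linarith
      then show "a \<in> ?I" by (rule abs_le_if_square_le)
    qed
    moreover have "binary_reps (m - 2 * a\<^sup>2) = {y. (a, y) \<in> ternary_reps m}" for a
      by (auto simp: binary_reps_def ternary_reps_def)
    ultimately show ?thesis
      using sum_slices[of ?I "ternary_reps m" parity_sign] finite_ternary_reps signed_ternary_sum_zero[OF assms] by simp
  qed
  ultimately show ?thesis
    by (simp add: right_diff_distrib sum_subtractf sum_distrib_left[symmetric] mult.left_commute[of _ 2])
qed

text \<open>In the rule for \<open>r(4 m)\<close> with \<open>m = k - a\<^sup>2\<close> the sign \<open>(-1)\<^sup>m\<close> absorbs the sign \<open>(-1)\<^sup>a\<close>, so that the
  signed sum becomes an unsigned number of solutions.\<close>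
lemma signed_count_quadruple:
  assumes "\<not> 9 dvd k"
  shows "3 dvd signed_count (4 * k)"
proof -
  let ?I = "{- (4 * k)..4 * k}"
  let ?r = "\<lambda>m. int (card (quaternary_reps m))"
  have "3 dvd (\<Sum>a\<in>?I. parity_sign a * (?r (4 * (k - a\<^sup>2)) - parity_sign (k - a\<^sup>2) * ?r (k - a\<^sup>2)))"
    by (intro dvd_sum dvd_mult card_quaternary_quadruple)
  also have "(\<Sum>a\<in>?I. parity_sign a * (?r (4 * (k - a\<^sup>2)) - parity_sign (k - a\<^sup>2) * ?r (k - a\<^sup>2)))
      = (\<Sum>a\<in>?I. parity_sign a * ?r (4 * k - 4 * a\<^sup>2) - parity_sign k * ?r (k - a\<^sup>2))"
    by (rule sum.cong) (auto simp: parity_sign_def right_diff_distrib)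
  also have "\<dots> = signed_count (4 * k) - parity_sign k * (\<Sum>a\<in>?I. ?r (k - a\<^sup>2))"
    by (simp add: signed_count_def sum_subtractf sum_distrib_left)
  also have "(\<Sum>a\<in>?I. ?r (k - a\<^sup>2)) = int (card (quinary_reps k))"
  proof -
    have "fst ` quinary_reps k \<subseteq> ?I"
    proof
      fix a assume "a \<in> fst ` quinary_reps k"
      then obtain b c d e where "a\<^sup>2 + b\<^sup>2 + c\<^sup>2 + 3 * d\<^sup>2 + 3 * e\<^sup>2 = k" by (auto simp: quinary_reps_def)
      moreover have "a\<^sup>2 \<ge> 0" "b\<^sup>2 \<ge> 0" "c\<^sup>2 \<ge> 0" "d\<^sup>2 \<ge> 0" "e\<^sup>2 \<ge> 0" by simp_all
      ultimately have "a\<^sup>2 \<le> 4 * k" by linarith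
      then show "a \<in> ?I" by (rule abs_le_if_square_le)
    qed
    moreover have "quaternary_reps (k - a\<^sup>2) = {y. (a, y) \<in> quinary_reps k}" for a
      by (auto simp: quaternary_reps_def quinary_reps_def)
    ultimately show ?thesis
      using sum_slices[of ?I "quinary_reps k" "\<lambda>_. 1"] finite_quinary_reps by simp
  qed
  finally show ?thesis
    using card_quinary_mod_3[OF assms] by (metis dvd_add dvd_mult diff_add_cancel)
qed

section \<open>The congruence for the series\<close>

lemma three_dvd_fps_iff: "(3 :: int fps) dvd f \<longleftrightarrow> (\<forall>n. 3 dvd f $ n)"
proof
  assume "\<forall>n. 3 dvd f $ n"
  then have "f = 3 * Abs_fps (\<lambda>n. f $ n div 3)"
    by (intro fps_ext) (simp add: numeral_fps_const)
  then show "3 dvd f" by (rule dvdI)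
qed (auto simp: numeral_fps_const)

text \<open>Cyclic permutation of \<open>x, y, z\<close> acts on the terms of the cube; the fixed triples \<open>x = y = z\<close> have
  sign \<open>(-1)\<^sup>x\<close> and exponent \<open>3 k x\<^sup>2\<close>.\<close>
lemma theta_cube_mod_3:
  assumes "k > 0"
  shows "3 dvd theta k ^ 3 - theta (3 * k)"
  unfolding three_dvd_fps_iff
proof
  fix n
  let ?e = "\<lambda>x::int. k * nat \<bar>x\<bar> ^ 2"
  let ?X = "{z \<in> UNIV \<times> UNIV \<times> UNIV. (\<lambda>(x, y, z). ?e x + (?e y + ?e z)) z = n}"
  let ?w = "\<lambda>(x, y, z). parity_sign x * (parity_sign y * parity_sign z)"
  let ?f = "\<lambda>(x, y, z). (y, z, x)"
  have fib: "finite {x \<in> UNIV. ?e x = n}" for n by (rule finite_theta_fibres[OF assms])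
  have fib2: "finite {z \<in> UNIV \<times> UNIV. (\<lambda>(x, y). ?e x + ?e y) z = n}" for n
    by (rule finite_fibres_Times) (rule fib)+
  have prod: "theta k ^ 3 = weighted_series (UNIV \<times> UNIV \<times> UNIV) (\<lambda>(x, y, z). ?e x + (?e y + ?e z)) ?w"
  proof -
    have "theta k ^ 3 = theta k * (theta k * theta k)" by (simp add: power3_eq_cube)
    also have "theta k * theta k = weighted_series (UNIV \<times> UNIV) (\<lambda>(x, y). ?e x + ?e y)
        (\<lambda>(x, y). parity_sign x * parity_sign y)"
      unfolding theta_def by (rule weighted_series_mult) (rule fib)+
    also have "theta k * \<dots> = weighted_series (UNIV \<times> UNIV \<times> UNIV)
        (\<lambda>(x, yz). ?e x + (case yz of (y, z) \<Rightarrow> ?e y + ?e z))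
            (\<lambda>(x, yz). parity_sign x * (case yz of (y, z) \<Rightarrow> parity_sign y * parity_sign z))"
      unfolding theta_def by (rule weighted_series_mult) (rule fib, rule fib2)
    finally show ?thesis by (simp add: case_prod_unfold)
  qed
  have "finite ?X"
    using finite_fibres_Times[OF fib fib2, of n] by (simp add: case_prod_beta)
  then have "3 dvd sum ?w ?X - sum ?w {z \<in> ?X. ?f z = z}"
    by (rule sum_eq_sum_fixed_points_mod_3) auto
  moreover have "sum ?w ?X = (theta k ^ 3) $ n"
    by (simp add: prod weighted_series_nth)
  moreover have "sum ?w {z \<in> ?X. ?f z = z} = theta (3 * k) $ n"
  proof -
    have "?f z = z \<longleftrightarrow> (\<exists>x. z = (x, x, x))" for z :: "int \<times> int \<times> int"
    proof -
      obtain x y w where z: "z = (x, y, w)" by (cases z)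
      show ?thesis unfolding z prod.case prod.inject by metis
    qed
    then have "{z \<in> ?X. ?f z = z} = (\<lambda>x. (x, x, x)) ` {x \<in> UNIV. 3 * k * nat \<bar>x\<bar> ^ 2 = n}"
      by auto
    then have "sum ?w {z \<in> ?X. ?f z = z}
        = (\<Sum>x\<in>{x \<in> UNIV. 3 * k * nat \<bar>x\<bar> ^ 2 = n}. ?w (x, x, x))"
      by (simp only:) (subst sum.reindex, auto simp: inj_on_def)
    also have "\<dots> = (\<Sum>x\<in>{x \<in> UNIV. 3 * k * nat \<bar>x\<bar> ^ 2 = n}. parity_sign x)"
      by (rule sum.cong) (auto simp: parity_sign_def)
    finally show ?thesis by (simp add: theta_def weighted_series_nth)
  qed
  ultimately show "3 dvd (theta k ^ 3 - theta (3 * k)) $ n" by simp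
qed

lemma theta_product_nth:
  "(theta 4 * (theta 1 * (theta 1 * (theta 3 * theta 3)))) $ n = parity_sign (int n) * signed_count (int n)"
proof -
  let ?e = "\<lambda>k (x::int). k * nat \<bar>x\<bar> ^ 2"
  let ?Z = "{(a, y). y \<in> quaternary_reps (int n - 4 * a\<^sup>2)}"
  have fib: "finite {x \<in> UNIV. ?e 1 x = n}" "finite {x \<in> UNIV. ?e 3 x = n}"
    "finite {x \<in> UNIV. ?e 4 x = n}" for n
    by (rule finite_theta_fibres, simp)+
  have "theta 4 * (theta 1 * (theta 1 * (theta 3 * theta 3))) = weighted_series UNIV
      (\<lambda>(a, b, c, d, e). ?e 4 a + (?e 1 b + (?e 1 c + (?e 3 d + ?e 3 e))))
      (\<lambda>(a, b, c, d, e). parity_sign a * (parity_sign b * (parity_sign c * (parity_sign d * parity_sign e))))"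
    unfolding theta_def
    by (simp only: weighted_series_mult finite_fibres_Times fib) (simp add: case_prod_unfold)
  then have "(theta 4 * (theta 1 * (theta 1 * (theta 3 * theta 3)))) $ n
      = (\<Sum>(a, b, c, d, e)\<in>{z. (case z of (a, b, c, d, e) \<Rightarrow>
          ?e 4 a + (?e 1 b + (?e 1 c + (?e 3 d + ?e 3 e))))
              = n}. parity_sign a * (parity_sign b * (parity_sign c * (parity_sign d * parity_sign e))))"
    by (simp add: weighted_series_nth)
  also have "{z. (case z of (a, b, c, d, e) \<Rightarrow>
          ?e 4 a + (?e 1 b + (?e 1 c + (?e 3 d + ?e 3 e)))) = n} = ?Z"
  proof -
    have eq: "?e 4 a + (?e 1 b + (?e 1 c + (?e 3 d + ?e 3 e))) = n
        \<longleftrightarrow> (b, c, d, e) \<in> quaternary_reps (int n - 4 * a\<^sup>2)" for a b c d e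
      unfolding quaternary_reps_def of_nat_eq_iff[symmetric, where 'a = int] by auto
    show ?thesis
      by (intro set_eqI) (simp only: split_paired_all mem_Collect_eq prod.case eq)
  qed
  also have "(\<Sum>(a, b, c, d, e)\<in>?Z. parity_sign a * (parity_sign b * (parity_sign c * (parity_sign d * parity_sign e))))
      = (\<Sum>z\<in>?Z. parity_sign (int n) * parity_sign (fst z))"
  proof (rule sum.cong[OF refl])
    fix z assume "z \<in> ?Z"
    moreover obtain a b c d e where z: "z = (a, b, c, d, e)" by (cases z)
    ultimately have "even (int n - 4 * a\<^sup>2) \<longleftrightarrow> even (b + c + d + e)"
      using quaternary_parity by blast
    then have "even (int n) \<longleftrightarrow> even (b + c + d + e)" by simp
    then have "parity_sign (int n) = parity_sign (b + c + d + e)" by (simp add: parity_sign_def)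
    then show "(case z of (a, b, c, d, e) \<Rightarrow> parity_sign a * (parity_sign b * (parity_sign c * (parity_sign d * parity_sign e)))) = parity_sign (int n) * parity_sign (fst z)"
      unfolding z by (simp add: parity_sign_add mult_ac)
  qed
  also have "\<dots> = parity_sign (int n) * signed_count (int n)"
  proof -
    have sub: "fst ` ?Z \<subseteq> {- int n..int n}"
    proof
      fix a assume "a \<in> fst ` ?Z"
      then obtain b c d e where "b\<^sup>2 + c\<^sup>2 + 3 * d\<^sup>2 + 3 * e\<^sup>2 = int n - 4 * a\<^sup>2" by (auto simp: quaternary_reps_def)
      moreover have "a\<^sup>2 \<ge> 0" "b\<^sup>2 \<ge> 0" "c\<^sup>2 \<ge> 0" "d\<^sup>2 \<ge> 0" "e\<^sup>2 \<ge> 0" by simp_all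
      ultimately have "a\<^sup>2 \<le> int n" by linarith
      then show "a \<in> {- int n..int n}" by (rule abs_le_if_square_le)
    qed
    have "?Z \<subseteq> (SIGMA a:{- int n..int n}. quaternary_reps (int n - 4 * a\<^sup>2))"
      using sub by force
    then have "finite ?Z" by (rule finite_subset) (simp add: finite_quaternary_reps)
    from sum_slices[OF _ this sub, of parity_sign] show ?thesis
      by (simp add: signed_count_def sum_distrib_left[symmetric])
  qed
  finally show ?thesis .
qed

lemma Rbar_series_mod_3:
  "3 dvd theta 4 * (theta 1 * (theta 1 * (theta 3 * theta 3))) - Abs_fps (\<lambda>n. int (Rbar 4 9 n)) * theta 36"
proof -
  let ?R = "Abs_fps (\<lambda>n. int (Rbar 4 9 n))"
  let ?G = "overpart_series {x. 0 < x \<and> 9 dvd x}"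
  let ?D = "theta 4 * (theta 1 * (theta 1 * (theta 3 * theta 3))) - ?R * theta 36"
  obtain u v where "theta 1 ^ 3 - theta 3 = 3 * u" "theta 3 ^ 3 - theta 9 = 3 * v"
    using theta_cube_mod_3[of 1] theta_cube_mod_3[of 3] by (auto elim!: dvdE)
  moreover have "coprime 4 (9 :: nat)" by code_simp
  then have "?R * theta 1 * theta 36 = theta 4 * theta 9"
    using Rbar_series[of 4 9] by simp
  moreover have "theta 9 * ?G = 1" by (rule theta_mult_overpart_series) simp
  \<comment> \<open>\<open>?G\<close> inverts \<open>theta 9\<close>, and \<open>theta 1 ^ 3 * theta 3 ^ 2\<close> is \<open>theta 9\<close> plus
      \<open>3 * (u * theta 3 ^ 2 + v)\<close>.\<close>
  ultimately have "?D = 3 * (?G * ?R * theta 36 * (u * theta 3 ^ 2 + v))"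
    by algebra
  then show ?thesis by (rule dvdI)
qed

text \<open>All exponents of \<open>\<theta>\<^sub>3\<^sub>6\<close> are multiples of 36, so the product with it relates \<open>Rbar 4 9 n\<close> only
  to values at smaller arguments in the same class modulo 18.\<close>
lemma three_dvd_Rbar_if_three_dvd_signed_count:
  assumes "\<And>n. n mod 18 = c \<Longrightarrow> 3 dvd signed_count (int n)" "n mod 18 = c"
  shows "3 dvd int (Rbar 4 9 n)"
  using assms(2)
proof (induction n rule: less_induct)
  case (less n)
  let ?R = "Abs_fps (\<lambda>n. int (Rbar 4 9 n))"
  have theta0: "theta 36 $ 0 = 1" by (simp add: theta_def weighted_series_nth parity_sign_def)
  have "3 dvd parity_sign (int n) * signed_count (int n) - (?R * theta 36) $ n"
    using Rbar_series_mod_3 unfolding three_dvd_fps_iff fps_sub_nth theta_product_nth by blast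
  moreover have "3 dvd parity_sign (int n) * signed_count (int n)"
    using assms(1)[OF less.prems] by simp
  ultimately have "3 dvd (?R * theta 36) $ n" by (metis dvd_diff diff_diff_eq2 add_diff_cancel_left')
  also have "(?R * theta 36) $ n = int (Rbar 4 9 n) + (\<Sum>i\<in>{1..n}. theta 36 $ i * int (Rbar 4 9 (n - i)))"
    by (subst mult.commute) (simp add: fps_mult_nth sum.atLeast_Suc_atMost theta0)
  finally have "3 dvd int (Rbar 4 9 n) + (\<Sum>i\<in>{1..n}. theta 36 $ i * int (Rbar 4 9 (n - i)))" .
  moreover have "3 dvd (\<Sum>i\<in>{1..n}. theta 36 $ i * int (Rbar 4 9 (n - i)))"
  proof (rule dvd_sum)
    fix i assume i: "i \<in> {1..n}"
    show "3 dvd theta 36 $ i * int (Rbar 4 9 (n - i))"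
    proof (cases "36 dvd i")
      case True
      then obtain j where "i = 36 * j" by blast
      then have "n = (n - i) + 18 * (2 * j)" using i by simp
      then have "(n - i) mod 18 = c" using less.prems by (metis mod_mult_self2)
      then show ?thesis using less.IH[of "n - i"] i by simp
    next
      case False
      then have "{x \<in> UNIV. 36 * nat \<bar>x::int\<bar> ^ 2 = i} = {}" by auto
      then have "theta 36 $ i = 0" by (simp add: theta_def weighted_series_nth)
      then show ?thesis by simp
    qed
  qed
  ultimately show ?case by (simp add: dvd_add_left_iff)
qed

theorem theorem5p2:
  fixes n :: nat
  shows "[Rbar 4 9 (18 * n + 12) = 0] (mod 3) \<and> [Rbar 4 9 (18 * n + 15) = 0] (mod 3)"
proof -
  have "3 dvd signed_count (int j)" if "j mod 18 = 12" for j
  proof (cases "4 dvd j")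
    case True
    then obtain k where "j = 4 * k" by blast
    moreover from this have "\<not> 9 dvd k" using that by presburger
    ultimately show ?thesis using signed_count_quadruple[of "int k"] by simp presburger
  next
    case False
    define m where "m = j div 2"
    have m: "j = 2 * m" "odd m" using that False unfolding m_def by presburger+
    have "int m mod 9 = 6" using that unfolding m_def by presburger
    then show ?thesis using signed_count_double[of "int m"] m by simp
  qed
  then have "3 dvd int (Rbar 4 9 (18 * n + 12))"
    by (rule three_dvd_Rbar_if_three_dvd_signed_count) simp_all
  moreover have "3 dvd signed_count (int j)" if "j mod 18 = 15" for j
    using that by (intro signed_count_15_mod_18) presburger
  then have "3 dvd int (Rbar 4 9 (18 * n + 15))"
    by (rule three_dvd_Rbar_if_three_dvd_signed_count) simp_all
  ultimately show ?thesis by (simp add: cong_0_iff flip: int_dvd_int_iff)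
qed

end
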